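(* Let $p \neq 2$ be a prime, $n \geq 2$, and let $A$ be a cyclic permutation group of order $p^n$ on a finite set. For $i \in \{1,\ldots,n\}$ let $k_i$ denote the number of orbits of $A$ of cardinality $p^i$. Then: (1) if $\sum_{i=1}^n k_i = 1$, then $A \notin GR$; (2) if $\sum_{i=1}^n k_i = 2$, then $A \in GR^*(3)$ when $k_1 \in \{1,2\}$ and $p \in \{3,5\}$, and $A \in GR(2)$ otherwise; (3) if $\sum_{i=1}^n k_i > 2$, then $A \in GR(2)$.
   Context: A cyclic permutation group is a permutation group generated by a single permutation; its order is the number of its elements. A $k$-colored graph $G=(V,E)$ consists of a finite set $V$ and a function $E$ from the 2-element subsets of $V$ to $\{0,\ldots,k-1\}$. An automorphism of $G$ is a permutation of $V$ preserving $E$; $Aut(G)$ is the automorphism group as a permutation group on $V$. $GR(k)$ is the class of permutation groups $(A,V)$ with $A=Aut(G)$ for some $k$-colored graph $G$ on $V$; $GR=\bigcup_k GR(k)$; $GR^*(k)=GR(k)\setminus GR(k-1)$. *)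

theory Defs
  imports
    "HOL-Algebra.Group_Action"
    "HOL-Algebra.Generated_Groups"
    "HOL-Combinatorics.Permutations"
    "HOL-Computational_Algebra.Primes"
    "HOL-Library.Ramsey"
begin

section \<open>Permutation groups\<close>

text \<open>
  A permutation group \<open>(A, V)\<close> is a subgroup \<open>A\<close> of the symmetric group on \<open>V\<close>. Permutations
  of \<open>V\<close> are functions on the whole type that are the identity outside \<open>V\<close> (\<open>permutes\<close>), so
  that equality of permutations of \<open>V\<close> is equality of functions.
\<close>

definition sym_group_on :: "'a set \<Rightarrow> ('a \<Rightarrow> 'a) monoid" where
  "sym_group_on V = \<lparr>carrier = {f. f permutes V}, monoid.mult = (\<circ>), one = id\<rparr>"

definition permutation_group :: "('a \<Rightarrow> 'a) set \<Rightarrow> 'a set \<Rightarrow> bool" where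
  "permutation_group A V \<longleftrightarrow> subgroup A (sym_group_on V)"

definition cyclic_permutation_group :: "('a \<Rightarrow> 'a) set \<Rightarrow> 'a set \<Rightarrow> bool" where
  "cyclic_permutation_group A V \<longleftrightarrow>
     permutation_group A V \<and> (\<exists>g \<in> carrier (sym_group_on V). A = generate (sym_group_on V) {g})"

definition perm_orbits :: "('a \<Rightarrow> 'a) set \<Rightarrow> 'a set \<Rightarrow> 'a set set" where
  "perm_orbits A V = orbits (sym_group_on V \<lparr>carrier := A\<rparr>) V (\<lambda>f. f)"

section \<open>Colored graphs and their automorphism groups\<close>

text \<open>
  The coloring \<open>E\<close> is a function on all sets of vertices, of which only the values on the
  two-element subsets \<open>[V]\<^bsup>2\<^esup>\<close> matter. Colors need not all be used, hence
  \<open>GR k \<subseteq> GR (Suc k)\<close>.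
\<close>

definition colored_graph :: "nat \<Rightarrow> 'a set \<Rightarrow> ('a set \<Rightarrow> nat) \<Rightarrow> bool" where
  "colored_graph k V E \<longleftrightarrow> finite V \<and> E \<in> [V]\<^bsup>2\<^esup> \<rightarrow> {..<k}"

definition Aut :: "'a set \<Rightarrow> ('a set \<Rightarrow> nat) \<Rightarrow> ('a \<Rightarrow> 'a) set" where
  "Aut V E = {f. f permutes V \<and> (\<forall>e \<in> [V]\<^bsup>2\<^esup>. E (f ` e) = E e)}"

definition GR :: "nat \<Rightarrow> (('a \<Rightarrow> 'a) set \<times> 'a set) set" where
  "GR k = {(A, V). permutation_group A V \<and> (\<exists>E. colored_graph k V E \<and> A = Aut V E)}"

definition GR_any :: "(('a \<Rightarrow> 'a) set \<times> 'a set) set" where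
  "GR_any = (\<Union>k. GR k)"

text \<open>Only used for \<open>k > 0\<close>; the truncated subtraction makes the value at \<open>0\<close> empty.\<close>

definition GR_star :: "nat \<Rightarrow> (('a \<Rightarrow> 'a) set \<times> 'a set) set" where
  "GR_star k = GR k - GR (k - 1)"

section \<open>Sanity checks\<close>

lemma group_sym_group_on: "group (sym_group_on V)"
  by (rule groupI)
     (auto simp: sym_group_on_def permutes_compose permutes_id comp_assoc
           intro: permutes_inv permutes_inv_o(2))

lemma perm_orbits_altdef: "perm_orbits A V = (\<lambda>v. (\<lambda>f. f v) ` A) ` V"
  unfolding perm_orbits_def orbits_def orbit_def by auto

lemma nsets_2_image:
  assumes "f permutes V" "e \<in> [V]\<^bsup>2\<^esup>"
  shows "f ` e \<in> [V]\<^bsup>2\<^esup>"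
  using assms permutes_in_image[OF assms(1)] permutes_inj[OF assms(1)]
  by (auto simp: nsets_def card_image inj_on_subset)

lemma permutation_group_Aut: "permutation_group (Aut V E) V"
proof -
  interpret group "sym_group_on V" by (rule group_sym_group_on)
  have inv: "inv\<^bsub>sym_group_on V\<^esub> f = Hilbert_Choice.inv f" if "f permutes V" for f
    using that by (intro inv_equality)
      (auto simp: sym_group_on_def permutes_inv permutes_inv_o(2))
  have "E (Hilbert_Choice.inv f ` e) = E e" if "f \<in> Aut V E" "e \<in> [V]\<^bsup>2\<^esup>" for f e
  proof -
    have f: "f permutes V" using that by (simp add: Aut_def)
    have "Hilbert_Choice.inv f ` e \<in> [V]\<^bsup>2\<^esup>"
      using nsets_2_image[OF permutes_inv[OF f]] that by blast
    then have "E (f ` Hilbert_Choice.inv f ` e) = E (Hilbert_Choice.inv f ` e)"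
      using that by (simp add: Aut_def)
    then show ?thesis
      by (simp add: image_f_inv_f permutes_surj[OF f])
  qed
  then have "inv\<^bsub>sym_group_on V\<^esub> f \<in> Aut V E" if "f \<in> Aut V E" for f
    using that inv by (auto simp: Aut_def permutes_inv)
  moreover have "f \<circ> g \<in> Aut V E" if "f \<in> Aut V E" "g \<in> Aut V E" for f g
    using that nsets_2_image[of g V] by (auto simp: Aut_def permutes_compose image_comp [symmetric] simp del: o_apply)
  moreover have "id \<in> Aut V E" by (simp add: Aut_def permutes_id)
  moreover have "Aut V E \<subseteq> carrier (sym_group_on V)" by (auto simp: Aut_def sym_group_on_def)
  ultimately show ?thesis
    unfolding permutation_group_def
    by (intro subgroupI) (auto simp: sym_group_on_def)
qed

lemma mem_GR_iff: "(A, V) \<in> GR k \<longleftrightarrow> (\<exists>E. colored_graph k V E \<and> A = Aut V E)"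
  by (auto simp: GR_def permutation_group_Aut)

end

theory Submission
  imports Defs "HOL-Algebra.Multiplicative_Group" "HOL-Combinatorics.Cycles"
begin

text \<open>
  Number the nontrivial orbits of \<open>A\<close> by decreasing size \<open>m\<^sub>0 = p\<^sup>n \<ge> m\<^sub>1 \<ge> \<dots>\<close> and identify
  orbit \<open>j\<close> with the integers modulo \<open>m\<^sub>j\<close>, so that \<open>A\<close> becomes the group of simultaneous
  rotations \<open>x \<mapsto> x + t\<close>. Fixed points can be added to a graph one at a time, as isolated or
  universal vertices.

  Negative results: a reflection \<open>x \<mapsto> a\<^sub>j - x\<close> on every orbit is not in \<open>A\<close>, but preserves
  every \<open>A\<close>-invariant coloring if there is only one orbit. For two orbits the coloring between
  them is a function of the difference modulo \<open>m\<^sub>1\<close>, and for \<open>m\<^sub>1 \<in> {3, 5}\<close> every subset of the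
  integers modulo \<open>m\<^sub>1\<close> is symmetric about some point.

  Positive results: put the complement of a cycle on orbit \<open>0\<close>; its vertices are recognized by
  their degree, so automorphisms act on them as \<open>x \<mapsto> t \<plusminus> x\<close>. The sign is forced to be \<open>+\<close> by joining
  vertices of orbits \<open>0\<close> and \<open>1\<close> whose difference lies in a set that is not symmetric about
  any point. This is \<open>{0, 1, 3}\<close> if \<open>m\<^sub>1 \<ge> 7\<close>, and if a third color is available its role is
  played by giving the differences \<open>0\<close> and \<open>1\<close> different colors. With at least three orbits one
  uses the differences \<open>{0, 1}\<close> between orbits \<open>0\<close> and \<open>1\<close>, and \<open>{0}\<close> between orbits \<open>0\<close>, \<open>2\<close> and
  \<open>1\<close>, \<open>2\<close>: a reflection cannot respect all three sides of this triangle. The remaining orbits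
  are attached as a chain, orbit \<open>j\<close> to orbit \<open>j + 1\<close> with difference \<open>0\<close>.
\<close>

section \<open>Edge colorings given by symmetric functions\<close>

lemma Aut_iff:
  "f \<in> Aut V E \<longleftrightarrow> f permutes V \<and> (\<forall>u\<in>V. \<forall>v\<in>V. u \<noteq> v \<longrightarrow> E {f u, f v} = E {u, v})"
proof
  assume "f \<in> Aut V E"
  then have "f permutes V" "\<And>e. e \<in> [V]\<^bsup>2\<^esup> \<Longrightarrow> E (f ` e) = E e" by (auto simp: Aut_def)
  from this(1) this(2)[of "{_, _}"]
  show "f permutes V \<and> (\<forall>u\<in>V. \<forall>v\<in>V. u \<noteq> v \<longrightarrow> E {f u, f v} = E {u, v})" by simp
next
  assume f: "f permutes V \<and> (\<forall>u\<in>V. \<forall>v\<in>V. u \<noteq> v \<longrightarrow> E {f u, f v} = E {u, v})"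
  have "E (f ` e) = E e" if e: "e \<in> [V]\<^bsup>2\<^esup>" for e
    using e by (rule nsets2_E) (use f in simp)
  with f show "f \<in> Aut V E" by (simp add: Aut_def)
qed

text \<open>Symmetry lets \<open>W\<close> descend to unordered pairs, so the graphs below can be
  given by colors of ordered pairs and their automorphisms tested on ordered pairs.\<close>

lemma GR_symI:
  fixes W :: "'a \<Rightarrow> 'a \<Rightarrow> nat"
  assumes "finite V" and sym: "\<And>u v. W u v = W v u" and "\<And>u v. W u v < k"
  shows "({f. f permutes V \<and> (\<forall>u\<in>V. \<forall>v\<in>V. u \<noteq> v \<longrightarrow> W (f u) (f v) = W u v)}, V) \<in> GR k"
proof -
  define E where "E e = (THE n. \<exists>u v. e = {u, v} \<and> n = W u v)" for e
  have E: "E {u, v} = W u v" for u v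
    unfolding E_def by (rule the_equality) (auto simp: doubleton_eq_iff sym)
  have "colored_graph k V E"
    unfolding colored_graph_def using assms E by (auto elim!: nsets2_E)
  moreover have "{f. f permutes V \<and> (\<forall>u\<in>V. \<forall>v\<in>V. u \<noteq> v \<longrightarrow> W (f u) (f v) = W u v)} = Aut V E"
    by (auto simp: Aut_iff E)
  ultimately show ?thesis
    unfolding mem_GR_iff by blast
qed

text \<open>The new vertex is joined to all of \<open>V\<close> in a color \<open>a\<close> such
  that no old vertex has all its edges of color \<open>a\<close>. It is then the only vertex of this
  kind, so every automorphism fixes it. One of the colors 0 and 1 always qualifies, which is where
  \<open>k \<ge> 2\<close> enters.\<close>

lemma GR_insert:
  assumes "(A, V) \<in> GR k" and "k \<ge> 2" and "card V \<ge> 2" and "u \<notin> V"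
  shows "(A, insert u V) \<in> GR k"
proof -
  obtain E where E: "colored_graph k V E" and A: "A = Aut V E"
    using assms(1) by (auto simp: mem_GR_iff)
  have fin: "finite V" and Ek: "\<And>v w. v \<in> V \<Longrightarrow> w \<in> V \<Longrightarrow> v \<noteq> w \<Longrightarrow> E {v, w} < k"
    using E by (auto simp: colored_graph_def)
  text \<open>No graph with two or more vertices has both an isolated and a universal vertex.\<close>
  have "\<exists>a<2. \<forall>v\<in>V. \<exists>w\<in>V. w \<noteq> v \<and> E {v, w} \<noteq> a"
  proof (rule ccontr)
    assume "\<not> ?thesis"
    then obtain v0 v1 where v: "v0 \<in> V" "\<forall>w\<in>V. w \<noteq> v0 \<longrightarrow> E {v0, w} = 0"
        "v1 \<in> V" "\<forall>w\<in>V. w \<noteq> v1 \<longrightarrow> E {v1, w} = 1"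
      by (metis one_less_numeral_iff pos2 semiring_norm(76))
    show False
    proof (cases "v0 = v1")
      case True
      have "V \<noteq> {v0}" using assms(3) by auto
      then obtain w where "w \<in> V" "w \<noteq> v0" using v(1) by blast
      then show False using v True by force
    next
      case False
      then show False using v by (metis insert_commute zero_neq_one)
    qed
  qed
  then obtain a where "a < 2" and a: "\<And>v. v \<in> V \<Longrightarrow> \<exists>w\<in>V. w \<noteq> v \<and> E {v, w} \<noteq> a"
    by blast
  define E' where "E' e = (if u \<in> e then a else E e)" for e
  have E': "E' {v, w} = (if v = u \<or> w = u then a else E {v, w})" for v w
    by (auto simp: E'_def)
  have "colored_graph k (insert u V) E'"
    unfolding colored_graph_def using fin Ek \<open>a < 2\<close> assms(2)
    by (auto elim!: nsets2_E simp: E')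
  moreover have "A = Aut (insert u V) E'"
  proof (intro equalityI subsetI)
    fix f assume "f \<in> A"
    then have f: "f permutes V" "\<forall>v\<in>V. \<forall>w\<in>V. v \<noteq> w \<longrightarrow> E {f v, f w} = E {v, w}"
      by (auto simp: A Aut_iff)
    have fu: "f v = u \<longleftrightarrow> v = u" for v
      using f(1) assms(4) by (metis permutes_not_in permutes_inverses(2))
    show "f \<in> Aut (insert u V) E'"
      using f permutes_subset[OF f(1), of "insert u V"] by (auto simp: Aut_iff E' fu)
  next
    fix f assume "f \<in> Aut (insert u V) E'"
    then have f: "f permutes insert u V"
      and fE: "\<And>v w. v \<in> insert u V \<Longrightarrow> w \<in> insert u V \<Longrightarrow> v \<noteq> w \<Longrightarrow> E' {f v, f w} = E' {v, w}"
      by (auto simp: Aut_iff)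
    have fu: "f u = u"
    proof (rule ccontr)
      assume "f u \<noteq> u"
      then have "f u \<in> V" using permutes_in_image[OF f, of u] by auto
      then obtain w where w: "w \<in> V" "w \<noteq> f u" "E {f u, w} \<noteq> a" using a by blast
      then obtain z where z: "z \<in> insert u V" "w = f z"
        using permutes_image[OF f] by (metis imageE insertI2)
      then have "z \<noteq> u" using w by auto
      then have "E' {f u, f z} = a" using fE[of u z] z by (simp add: E')
      then show False using w z \<open>f u \<noteq> u\<close> assms(4) by (auto simp: E' split: if_splits)
    qed
    have fV: "f permutes V" by (rule permutes_superset[OF f]) (use fu in auto)
    have "E {f v, f w} = E {v, w}" if "v \<in> V" "w \<in> V" "v \<noteq> w" for v w
    proof -
      have "f v \<in> V" "f w \<in> V" using that permutes_in_image[OF fV] by auto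
      then show ?thesis using fE[of v w] that assms(4) by (auto simp: E' split: if_splits)
    qed
    then show "f \<in> A" using fV by (simp add: A Aut_iff)
  qed
  ultimately show ?thesis unfolding mem_GR_iff by blast
qed

lemma GR_superset:
  assumes "(A, U) \<in> GR k" and "k \<ge> 2" and "card U \<ge> 2" and "U \<subseteq> V" and "finite V"
  shows "(A, V) \<in> GR k"
proof -
  have "(A, U \<union> F) \<in> GR k" if "finite F" "F \<inter> U = {}" for F
    using that
  proof (induction F rule: finite_induct)
    case empty
    then show ?case using assms(1) by simp
  next
    case (insert u F)
    have "finite U" using assms(1) by (auto simp: mem_GR_iff colored_graph_def)
    then have "card (U \<union> F) \<ge> 2"
      using assms(3) insert.hyps(1) by (meson card_mono finite_UnI le_trans sup_ge1)
    then show ?case using GR_insert[of A "U \<union> F" k u] insert assms(2) by auto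
  qed
  from this[of "V - U"] show ?thesis
    using assms(4,5) by (simp add: Un_absorb1 Int_commute)
qed

section \<open>Coordinates\<close>

text \<open>The sign of the first step persists: two consecutive steps of opposite sign would return
  to the starting value modulo \<open>N\<close>.\<close>

lemma unit_steps_affine:
  fixes h :: "nat \<Rightarrow> int"
  assumes step: "\<And>i. N dvd h (Suc i) - h i - 1 \<or> N dvd h (Suc i) - h i + 1"
    and no_return: "\<And>i. \<not> N dvd h (Suc (Suc i)) - h i"
  shows "\<exists>\<epsilon>. (\<epsilon> = 1 \<or> \<epsilon> = -1) \<and> (\<forall>i. N dvd h i - (h 0 + \<epsilon> * int i))"
proof -
  obtain \<epsilon> where \<epsilon>: "\<epsilon> = 1 \<or> \<epsilon> = -1" "N dvd h (Suc 0) - h 0 - \<epsilon>"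
    using step[of 0] by (metis diff_minus_eq_add)
  have *: "N dvd h (Suc i) - h i - \<epsilon>" for i
  proof (induction i)
    case (Suc i)
    show ?case
    proof (rule ccontr)
      assume "\<not> ?thesis"
      then have "N dvd h (Suc (Suc i)) - h (Suc i) + \<epsilon>"
        using step[of "Suc i"] \<epsilon>(1) by auto
      then have "N dvd (h (Suc (Suc i)) - h (Suc i) + \<epsilon>) + (h (Suc i) - h i - \<epsilon>)"
        using Suc.IH by (rule dvd_add)
      then show False using no_return[of i] by simp
    qed
  qed (rule \<epsilon>(2))
  have "N dvd h i - (h 0 + \<epsilon> * int i)" for i
  proof (induction i)
    case (Suc i)
    from dvd_add[OF this *[of i]] show ?case by (simp add: algebra_simps)
  qed simp
  then show ?thesis using \<epsilon>(1) by blast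
qed

text \<open>Turns a condition on the difference of two positions into membership of one of them in a
  residue class.\<close>

lemma dvd_flip: "(d::int) dvd a - b - s \<longleftrightarrow> d dvd b - (a - s)"
  using dvd_minus_iff[of d "a - b - s"] by (simp add: algebra_simps)

text \<open>Used with \<open>y'\<close> the image of a vertex at \<open>y\<close> in an orbit where
  the action is already known, and \<open>z'\<close> the image of a neighbour: a difference
  \<open>s\<close> between the images then locates \<open>z'\<close> modulo
  \<open>d\<close>.\<close>

lemma affine_transfer:
  fixes d :: int
  assumes "d dvd N" "N dvd y' - (t + \<epsilon> * y)" "d dvd z' - y' - s" "d dvd y - b"
  shows "d dvd z' - (t + \<epsilon> * b) - s"
proof -
  have "d dvd y' - (t + \<epsilon> * y)" using assms(1,2) by (rule dvd_trans)
  then have "d dvd (z' - y' - s) + (y' - (t + \<epsilon> * y)) + \<epsilon> * (y - b)"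
    using assms(3,4) by (intro dvd_add dvd_mult)
  then show ?thesis by (simp add: algebra_simps)
qed

text \<open>
  The vertex \<open>v\<close> lies in the orbit with number \<open>c v\<close>, which is identified with the integers
  modulo \<open>m (c v)\<close>; its position \<open>x v\<close> there is only meaningful modulo \<open>m (c v)\<close>.
\<close>

locale coordinates =
  fixes V :: "'a set" and r :: nat and m :: "nat \<Rightarrow> int" and c :: "'a \<Rightarrow> nat" and x :: "'a \<Rightarrow> int"
  assumes finV: "finite V"
    and r_pos: "0 < r"
    and class_less: "v \<in> V \<Longrightarrow> c v < r"
    and vertex_eqI: "u \<in> V \<Longrightarrow> v \<in> V \<Longrightarrow> c u = c v \<Longrightarrow> m (c v) dvd x u - x v \<Longrightarrow> u = v"
    and vertex_ex: "j < r \<Longrightarrow> \<exists>v\<in>V. c v = j \<and> m j dvd x v - a"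
    and m_odd: "j < r \<Longrightarrow> odd (m j)"
    and m_ge: "j < r \<Longrightarrow> 3 \<le> m j"
    and m_dvd: "j \<le> k \<Longrightarrow> k < r \<Longrightarrow> m k dvd m j"
    and m_0_ge: "9 \<le> m 0"
begin

section \<open>Vertices by position, affine maps and residue classes\<close>

definition rotations :: "('a \<Rightarrow> 'a) set" where
  "rotations = {f. f permutes V \<and> (\<exists>t. \<forall>v\<in>V. c (f v) = c v \<and> m (c v) dvd x (f v) - (x v + t))}"

definition vertex :: "nat \<Rightarrow> int \<Rightarrow> 'a" where
  "vertex j a = (SOME v. v \<in> V \<and> c v = j \<and> m j dvd x v - a)"

lemma vertex:
  assumes "j < r"
  shows "vertex j a \<in> V" "c (vertex j a) = j" "m j dvd x (vertex j a) - a"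
  using someI_ex[of "\<lambda>v. v \<in> V \<and> c v = j \<and> m j dvd x v - a"] vertex_ex[OF assms, of a]
  unfolding vertex_def by blast+

lemma vertex_unique:
  assumes "v \<in> V" "c v = j" "m j dvd x v - a"
  shows "v = vertex j a"
proof -
  have j: "j < r" using assms class_less by auto
  have "m j dvd (x v - a) - (x (vertex j a) - a)"
    using assms(3) vertex(3)[OF j] by (rule dvd_diff)
  then show ?thesis using vertex_eqI[of v "vertex j a"] vertex(1,2)[OF j] assms by simp
qed

lemma vertex_eq_iff:
  assumes "j < r"
  shows "vertex j a = vertex j b \<longleftrightarrow> m j dvd a - b"
proof
  assume "vertex j a = vertex j b"
  with dvd_diff[OF vertex(3)[OF assms, of b] vertex(3)[OF assms, of a]]
  show "m j dvd a - b" by simp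
next
  assume "m j dvd a - b"
  from dvd_add[OF vertex(3)[OF assms, of a] this] have "m j dvd x (vertex j a) - b" by simp
  then show "vertex j a = vertex j b"
    by (intro vertex_unique vertex assms)
qed

text \<open>Multiplication by 1 or -1 is injective modulo every orbit length. The shift
  \<open>s\<close> may differ from orbit to orbit: constant shifts with sign 1 give rotations, while
  sign -1 with independent shifts gives the reflections of the negative results.\<close>

lemma ex_affine:
  assumes "\<epsilon> = 1 \<or> \<epsilon> = (-1::int)"
  obtains f where "f permutes V" "\<And>v. v \<in> V \<Longrightarrow> c (f v) = c v"
    "\<And>v. v \<in> V \<Longrightarrow> m (c v) dvd x (f v) - (s (c v) + \<epsilon> * x v)"
proof -
  define f where "f v = (if v \<in> V then vertex (c v) (s (c v) + \<epsilon> * x v) else v)" for v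
  have f: "f v \<in> V" "c (f v) = c v" "m (c v) dvd x (f v) - (s (c v) + \<epsilon> * x v)" if "v \<in> V" for v
    using vertex[OF class_less[OF that]] that by (simp_all add: f_def)
  have "inj_on f V"
  proof (rule inj_onI)
    fix u v assume uv: "u \<in> V" "v \<in> V" "f u = f v"
    have cc: "c u = c v" using f(2) uv by metis
    have "m (c v) dvd (x (f v) - (s (c v) + \<epsilon> * x v)) - (x (f u) - (s (c u) + \<epsilon> * x u))"
      using dvd_diff[OF f(3)[OF uv(2)] f(3)[OF uv(1), unfolded cc]] cc by simp
    then have "m (c v) dvd \<epsilon> * (x u - x v)"
      using uv(3) cc by (simp add: algebra_simps)
    then have "m (c v) dvd x u - x v" using assms by (auto simp: dvd_diff_commute)
    then show "u = v" using vertex_eqI uv cc by blast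
  qed
  then have "f permutes V"
    using finV f(1) by (intro inj_imp_permutes) (auto simp: f_def)
  then show ?thesis using that f by blast
qed

text \<open>With \<open>m j = d * q\<close>, the vertices counted are those at
  \<open>a + d * i\<close> for \<open>0 \<le> i < q\<close>.\<close>

lemma card_residue:
  assumes "j < r" "0 < d" "d dvd m j"
  shows "int (card {v \<in> V. c v = j \<and> d dvd x v - a}) = m j div d"
proof -
  obtain q where q: "m j = d * q" using assms(3) by (elim dvdE)
  have "q > 0" using m_ge[OF assms(1)] assms(2) q
    by (metis zero_less_mult_pos le_less_trans less_le_trans zero_less_numeral)
  have "bij_betw (\<lambda>i. vertex j (a + d * i)) {0..<q} {v \<in> V. c v = j \<and> d dvd x v - a}"
  proof (rule bij_betw_imageI)
    show "inj_on (\<lambda>i. vertex j (a + d * i)) {0..<q}"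
    proof (rule inj_onI)
      fix i k assume ik: "i \<in> {0..<q}" "k \<in> {0..<q}" "vertex j (a + d * i) = vertex j (a + d * k)"
      have "m j dvd (x (vertex j (a + d * k)) - (a + d * k)) - (x (vertex j (a + d * i)) - (a + d * i))"
        by (intro dvd_diff vertex(3) assms)
      then have "d * q dvd d * (i - k)" by (simp add: q ik(3) algebra_simps)
      then have "q dvd i - k" using assms(2) by simp
      then show "i = k" using ik(1,2)
        by (metis atLeastLessThan_iff mod_eq_dvd_iff mod_pos_pos_trivial)
    qed
    show "(\<lambda>i. vertex j (a + d * i)) ` {0..<q} = {v \<in> V. c v = j \<and> d dvd x v - a}"
    proof (intro equalityI subsetI)
      fix v assume "v \<in> (\<lambda>i. vertex j (a + d * i)) ` {0..<q}"
      then obtain i where i: "v = vertex j (a + d * i)" by blast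
      have "d dvd x v - (a + d * i)"
        using vertex(3)[OF assms(1)] assms(3) i dvd_trans by blast
      then have "d dvd (x v - (a + d * i)) + d * i" by (intro dvd_add) auto
      then show "v \<in> {v \<in> V. c v = j \<and> d dvd x v - a}"
        using vertex(1,2)[OF assms(1)] i by simp
    next
      fix v assume v: "v \<in> {v \<in> V. c v = j \<and> d dvd x v - a}"
      then obtain i where i: "x v - a = d * i" by (auto elim: dvdE)
      have "x v - (a + d * (i mod q)) = d * (i - i mod q)"
        using i by (simp add: algebra_simps)
      also have "m j dvd \<dots>" unfolding q by (simp add: minus_mod_eq_mult_div)
      finally have "v = vertex j (a + d * (i mod q))" using v by (intro vertex_unique) auto
      then show "v \<in> (\<lambda>i. vertex j (a + d * i)) ` {0..<q}"
        using \<open>q > 0\<close> by (intro image_eqI[of _ _ "i mod q"]) auto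
    qed
  qed
  from bij_betw_same_card[OF this] show ?thesis using q assms(2) \<open>q > 0\<close> by simp
qed

section \<open>The cycle on the longest orbit\<close>

definition adjacent_in_cycle :: "'a \<Rightarrow> 'a \<Rightarrow> bool" where
  "adjacent_in_cycle u v \<longleftrightarrow> m 0 dvd x u - x v - 1 \<or> m 0 dvd x u - x v + 1"

lemma adjacent_in_cycle_sym: "adjacent_in_cycle u v \<longleftrightarrow> adjacent_in_cycle v u"
proof -
  have "m 0 dvd x u - x v - 1 \<longleftrightarrow> m 0 dvd x v - x u + 1"
       "m 0 dvd x u - x v + 1 \<longleftrightarrow> m 0 dvd x v - x u - 1"
    using dvd_minus_iff[of "m 0" "x u - x v - 1"] dvd_minus_iff[of "m 0" "x u - x v + 1"]
    by (simp_all add: algebra_simps)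
  then show ?thesis by (auto simp: adjacent_in_cycle_def)
qed

lemma not_adjacent_in_cycle_self: "\<not> adjacent_in_cycle v v"
  using m_0_ge zdvd_imp_le[of "m 0" 1] by (auto simp: adjacent_in_cycle_def)

text \<open>Along the positions 0, 1, 2, ... of the cycle the images move by 1 or -1 at each step,
  and injectivity of \<open>f\<close> prevents a return after two steps because
  \<open>m 0 > 2\<close>.\<close>

lemma cycle_automorphism:
  assumes f: "f permutes V" "\<And>v. v \<in> V \<Longrightarrow> c v = 0 \<Longrightarrow> c (f v) = 0"
    and adj: "\<And>u v. u \<in> V \<Longrightarrow> v \<in> V \<Longrightarrow> c u = 0 \<Longrightarrow> c v = 0 \<Longrightarrow> adjacent_in_cycle u v \<Longrightarrow>
                  adjacent_in_cycle (f u) (f v)"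
  obtains \<epsilon> t where "\<epsilon> = 1 \<or> \<epsilon> = -1"
    "\<And>v. v \<in> V \<Longrightarrow> c v = 0 \<Longrightarrow> m 0 dvd x (f v) - (t + \<epsilon> * x v)"
proof -
  define w where "w i = vertex 0 (int i)" for i
  define h where "h i = x (f (w i))" for i
  have w: "w i \<in> V" "c (w i) = 0" "m 0 dvd x (w i) - int i" for i
    using vertex[OF r_pos] by (simp_all add: w_def)
  have fw: "f (w i) \<in> V" "c (f (w i)) = 0" for i
    using w f permutes_in_image[OF f(1)] by auto
  have step: "m 0 dvd h (Suc i) - h i - 1 \<or> m 0 dvd h (Suc i) - h i + 1" for i
  proof -
    have "m 0 dvd (x (w (Suc i)) - int (Suc i)) - (x (w i) - int i)"
      by (intro dvd_diff w)
    then have "adjacent_in_cycle (w (Suc i)) (w i)"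
      by (simp add: adjacent_in_cycle_def algebra_simps)
    then have "adjacent_in_cycle (f (w (Suc i))) (f (w i))" using adj w by blast
    then show ?thesis by (simp add: adjacent_in_cycle_def h_def)
  qed
  have no_return: "\<not> m 0 dvd h (Suc (Suc i)) - h i" for i
  proof
    assume "m 0 dvd h (Suc (Suc i)) - h i"
    then have "f (w (Suc (Suc i))) = f (w i)"
      using vertex_eqI[OF fw(1) fw(1)] fw(2) by (simp add: h_def)
    then have "w (Suc (Suc i)) = w i" using permutes_inj[OF f(1)] by (auto dest: injD)
    with dvd_diff[OF w(3)[of i] w(3)[of "Suc (Suc i)"]] show False using m_0_ge zdvd_imp_le[of "m 0" 2] by simp
  qed
  obtain \<epsilon> where \<epsilon>: "\<epsilon> = 1 \<or> \<epsilon> = -1" "\<And>i. m 0 dvd h i - (h 0 + \<epsilon> * int i)"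
    using unit_steps_affine[of "m 0" h] step no_return by blast
  have "m 0 dvd x (f v) - (h 0 + \<epsilon> * x v)" if v: "v \<in> V" "c v = 0" for v
  proof -
    define i where "i = nat (x v mod m 0)"
    have i: "int i = x v mod m 0" using m_0_ge by (simp add: i_def)
    have "m 0 dvd x v - int i" by (simp add: i minus_mod_eq_mult_div)
    then have "v = w i" using vertex_unique[OF v] by (simp add: w_def)
    have "m 0 dvd h i - (h 0 + \<epsilon> * int i) - \<epsilon> * (x v - int i)"
      by (rule dvd_diff[OF \<epsilon>(2)[of i] dvd_mult[OF \<open>m 0 dvd x v - int i\<close>]])
    then show ?thesis unfolding h_def \<open>v = w i\<close>[symmetric] by (simp add: algebra_simps)
  qed
  with \<epsilon>(1) that show ?thesis by blast
qed

text \<open>A vertex and its two neighbours on the cycle are three distinct vertices, since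
  \<open>m 0\<close> divides neither 1 nor 2.\<close>

lemma card_cocycle:
  assumes "v \<in> V" "c v = 0"
  shows "int (card {w \<in> V. c w = 0 \<and> w \<noteq> v \<and> \<not> adjacent_in_cycle v w}) = m 0 - 3"
proof -
  let ?U = "{w \<in> V. c w = 0}"
  let ?D = "{vertex 0 (x v), vertex 0 (x v + 1), vertex 0 (x v - 1)}"
  have iff: "m 0 dvd x w - a \<longleftrightarrow> w = vertex 0 a" if "w \<in> V" "c w = 0" for w a
    using vertex_unique[OF that] vertex(3)[OF r_pos] by blast
  have adj: "adjacent_in_cycle v w \<longleftrightarrow> w = vertex 0 (x v + 1) \<or> w = vertex 0 (x v - 1)"
    if "w \<in> V" "c w = 0" for w
  proof -
    have "x w - x v - 1 = x w - (x v + 1)" "x w - x v + 1 = x w - (x v - 1)" by simp_all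
    then show ?thesis
      using iff[OF that] by (subst adjacent_in_cycle_sym) (simp only: adjacent_in_cycle_def)
  qed
  have "?D \<subseteq> ?U" using vertex[OF r_pos] by auto
  moreover have "vertex 0 (x v) \<noteq> vertex 0 (x v + 1)" "vertex 0 (x v) \<noteq> vertex 0 (x v - 1)"
      "vertex 0 (x v + 1) \<noteq> vertex 0 (x v - 1)"
    using m_0_ge zdvd_imp_le[of "m 0" 1] zdvd_imp_le[of "m 0" 2]
    by (auto simp: vertex_eq_iff[OF r_pos])
  then have card_D: "card ?D = 3" by simp
  moreover have "{w \<in> V. c w = 0 \<and> w \<noteq> v \<and> \<not> adjacent_in_cycle v w} = ?U - ?D"
    using adj iff[OF assms, of "x v"] by auto
  moreover have "int (card ?U) = m 0"
    using card_residue[OF r_pos, of 1 0] by simp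
  moreover have "card ?D \<le> card ?U"
    using finV \<open>?D \<subseteq> ?U\<close> by (intro card_mono) auto
  ultimately show ?thesis using finV card_D by (simp add: card_Diff_subset)
qed

declare One_nat_def [simp del]

lemma card_V_ge: "2 \<le> card V"
proof -
  have "int (card {v \<in> V. c v = 0 \<and> 1 dvd x v - 0}) = m 0"
    using card_residue[OF r_pos, of 1 0] by simp
  moreover have "card {v \<in> V. c v = 0 \<and> 1 dvd x v - 0} \<le> card V"
    using finV by (intro card_mono) auto
  ultimately show ?thesis using m_0_ge by linarith
qed

section \<open>Automorphisms of colorings, degrees and neighbourhoods\<close>

definition preserves :: "('a \<Rightarrow> 'a \<Rightarrow> nat) \<Rightarrow> ('a \<Rightarrow> 'a) \<Rightarrow> bool" where
  "preserves W f \<longleftrightarrow> f permutes V \<and> (\<forall>u\<in>V. \<forall>v\<in>V. u \<noteq> v \<longrightarrow> W (f u) (f v) = W u v)"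

lemma rotations_in_GR:
  assumes "\<And>u v. W u v = W v u" and "\<And>u v. W u v < k"
    and "\<And>f. f \<in> rotations \<Longrightarrow> preserves W f" and "\<And>f. preserves W f \<Longrightarrow> f \<in> rotations"
  shows "(rotations, V) \<in> GR k"
proof -
  have "rotations = {f. f permutes V \<and> (\<forall>u\<in>V. \<forall>v\<in>V. u \<noteq> v \<longrightarrow> W (f u) (f v) = W u v)}"
    using assms(3,4) by (auto simp: preserves_def)
  then show ?thesis using GR_symI[OF finV assms(1,2)] by simp
qed

lemma rotation_permutes: "f \<in> rotations \<Longrightarrow> f permutes V"
  by (simp add: rotations_def)

lemma rotation_class: "f \<in> rotations \<Longrightarrow> v \<in> V \<Longrightarrow> c (f v) = c v"
  by (auto simp: rotations_def)

text \<open>A rotation adds the same shift to both positions, so their difference is unchanged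
  modulo every common divisor of the two orbit lengths.\<close>

lemma rotation_dvd_iff:
  assumes "f \<in> rotations" "u \<in> V" "v \<in> V" "d dvd m (c u)" "d dvd m (c v)"
  shows "d dvd x (f u) - x (f v) - s \<longleftrightarrow> d dvd x u - x v - s"
proof -
  obtain t where "\<forall>v\<in>V. c (f v) = c v \<and> m (c v) dvd x (f v) - (x v + t)"
    using assms(1) by (auto simp: rotations_def)
  then have "d dvd x (f u) - (x u + t)" "d dvd x (f v) - (x v + t)"
    using assms dvd_trans by blast+
  from dvd_diff[OF this] have "d dvd (x (f u) - x (f v) - s) - (x u - x v - s)"
    by (simp add: algebra_simps)
  then show ?thesis by (metis dvd_diff_right_iff dvd_diff_left_iff)
qed

lemma rotation_dvd_iff_0:
  assumes "f \<in> rotations" "u \<in> V" "v \<in> V" "d dvd m (c u)" "d dvd m (c v)"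
  shows "d dvd x (f u) - x (f v) \<longleftrightarrow> d dvd x u - x v"
  using rotation_dvd_iff[OF assms, of 0] by simp

lemma rotation_adjacent_in_cycle:
  assumes "f \<in> rotations" "u \<in> V" "v \<in> V" "c u = 0" "c v = 0"
  shows "adjacent_in_cycle (f u) (f v) \<longleftrightarrow> adjacent_in_cycle u v"
  using rotation_dvd_iff[OF assms(1-3), of "m 0" 1] rotation_dvd_iff[OF assms(1-3), of "m 0" "-1"] assms(4,5)
  by (simp add: adjacent_in_cycle_def)

lemma preserves_permutes: "preserves W f \<Longrightarrow> f permutes V"
  by (simp add: preserves_def)

lemma preserves_in: "preserves W f \<Longrightarrow> f v \<in> V \<longleftrightarrow> v \<in> V"
  by (metis permutes_in_image preserves_permutes)

lemma preserves_eq: "preserves W f \<Longrightarrow> u \<in> V \<Longrightarrow> v \<in> V \<Longrightarrow> u \<noteq> v \<Longrightarrow> W (f u) (f v) = W u v"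
  by (simp add: preserves_def)

text \<open>\<open>P\<close> stands for a vertex property already known to be invariant: the
  constantly true one gives invariance of degrees, membership in orbit 0 gives invariance of the
  number of neighbours there.\<close>

lemma card_neighbours_preserved:
  assumes "preserves W f" "u \<in> V" and P: "\<And>w. w \<in> V \<Longrightarrow> P (f w) \<longleftrightarrow> P w"
  shows "card {w \<in> V. w \<noteq> f u \<and> P w \<and> W (f u) w = a} = card {w \<in> V. w \<noteq> u \<and> P w \<and> W u w = a}"
proof -
  have inj: "inj f" and surj: "f ` V = V"
    using preserves_permutes[OF assms(1)] permutes_inj permutes_image by blast+
  have "{w \<in> V. w \<noteq> f u \<and> P w \<and> W (f u) w = a} = f ` {w \<in> V. w \<noteq> u \<and> P w \<and> W u w = a}"
  proof (intro equalityI subsetI)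
    fix w assume w: "w \<in> {w \<in> V. w \<noteq> f u \<and> P w \<and> W (f u) w = a}"
    then obtain z where z: "z \<in> V" "w = f z" using surj by blast
    moreover have "z \<noteq> u" using w z by auto
    moreover have "P z" using w z P by auto
    moreover have "W u z = a" using w z preserves_eq[OF assms(1,2), of z] \<open>z \<noteq> u\<close> by auto
    ultimately show "w \<in> f ` {w \<in> V. w \<noteq> u \<and> P w \<and> W u w = a}" by blast
  next
    fix w assume "w \<in> f ` {w \<in> V. w \<noteq> u \<and> P w \<and> W u w = a}"
    then obtain z where "z \<in> V" "w = f z" "z \<noteq> u" "P z" "W u z = a" by blast
    then show "w \<in> {w \<in> V. w \<noteq> f u \<and> P w \<and> W (f u) w = a}"
      using preserves_eq[OF assms(1,2), of z] preserves_in[OF assms(1)] P inj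
      by (auto dest: injD)
  qed
  then show ?thesis using inj by (simp add: card_image inj_on_subset[OF _ subset_UNIV])
qed

definition degree :: "('a \<Rightarrow> 'a \<Rightarrow> nat) \<Rightarrow> 'a \<Rightarrow> int" where
  "degree W u = int (card {w \<in> V. w \<noteq> u \<and> W u w = 1})"

lemma degree_preserved: "preserves W f \<Longrightarrow> u \<in> V \<Longrightarrow> degree W (f u) = degree W u"
  using card_neighbours_preserved[of W f u "\<lambda>_. True" 1] by (simp add: degree_def)

text \<open>
  In every construction below, color 1 puts the complement of a cycle on the longest orbit. This
  makes its vertices those of large degree, so that the orbit is invariant under automorphisms.
\<close>

definition cocycle :: "('a \<Rightarrow> 'a \<Rightarrow> nat) \<Rightarrow> bool" where
  "cocycle W \<longleftrightarrow> (\<forall>u\<in>V. \<forall>v\<in>V. c u = 0 \<longrightarrow> c v = 0 \<longrightarrow> W u v = of_bool (\<not> adjacent_in_cycle u v))"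

text \<open>The \<open>m 0 - 3\<close> neighbours inside orbit 0 are disjoint from \<open>T\<close>,
  which lies outside it.\<close>

lemma degree_ge:
  assumes "cocycle W" "v \<in> V" "c v = 0" "T \<subseteq> V" "\<And>w. w \<in> T \<Longrightarrow> c w \<noteq> 0"
    and W: "\<And>w. w \<in> T \<Longrightarrow> W v w = 1"
  shows "m 0 - 3 + int (card T) \<le> degree W v"
proof -
  let ?U = "{w \<in> V. c w = 0 \<and> w \<noteq> v \<and> \<not> adjacent_in_cycle v w}"
  have "?U \<inter> T = {}" using assms(5) by blast
  then have "card (?U \<union> T) = card ?U + card T"
    using finV assms(4) by (intro card_Un_disjoint) (auto intro: finite_subset)
  moreover have "?U \<union> T \<subseteq> {w \<in> V. w \<noteq> v \<and> W v w = 1}"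
    using assms(1-4) assms(5)[of v] W by (auto simp: cocycle_def)
  then have "card (?U \<union> T) \<le> card {w \<in> V. w \<noteq> v \<and> W v w = 1}"
    using finV by (intro card_mono) auto
  ultimately show ?thesis using card_cocycle[OF assms(2,3)] by (simp add: degree_def)
qed

text \<open>Distinct vertices of orbit 0 are adjacent on the cycle exactly if their edge has color
  0, so an automorphism preserving the orbit acts on it as an automorphism of the cycle.\<close>

lemma cocycle_automorphism:
  assumes "cocycle W" "preserves W f" and cl: "\<And>v. v \<in> V \<Longrightarrow> c v = 0 \<Longrightarrow> c (f v) = 0"
  obtains \<epsilon> t where "\<epsilon> = 1 \<or> \<epsilon> = -1"
    "\<And>v. v \<in> V \<Longrightarrow> c v = 0 \<Longrightarrow> m 0 dvd x (f v) - (t + \<epsilon> * x v)"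
proof (rule cycle_automorphism[of f])
  fix u v assume uv: "u \<in> V" "v \<in> V" "c u = 0" "c v = 0" "adjacent_in_cycle u v"
  then have "u \<noteq> v" using not_adjacent_in_cycle_self by auto
  then show "adjacent_in_cycle (f u) (f v)"
    using preserves_eq[OF assms(2), of u v] uv assms(1) cl preserves_in[OF assms(2)]
    by (auto simp: cocycle_def)
qed (use assms preserves_permutes that in auto)

text \<open>In the constructions, the neighbours of a vertex in another orbit form a union of such
  sets.\<close>

definition residue_class :: "nat \<Rightarrow> int \<Rightarrow> int \<Rightarrow> 'a set" where
  "residue_class j d a = {v \<in> V. c v = j \<and> d dvd x v - a}"

lemma finite_residue_class [simp]: "finite (residue_class j d a)"
  using finV by (simp add: residue_class_def)

text \<open>The class has \<open>m k div m j\<close> elements, and \<open>m j \<ge> 3\<close>. This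
  keeps degrees outside orbit 0 small.\<close>

lemma card_residue_class_le:
  assumes "k \<le> j" "j < r"
  shows "3 * int (card (residue_class k (m j) a)) \<le> m 0"
proof -
  have k: "k < r" using assms by simp
  have "3 * (m k div m j) \<le> m j * (m k div m j)"
    using m_ge[OF assms(2)] m_ge[OF k] by (intro mult_right_mono) (simp_all add: pos_imp_zdiv_nonneg_iff)
  also have "\<dots> = m k" using m_dvd[OF assms] by simp
  also have "m k \<le> m 0" using m_dvd[of 0 k] k m_0_ge by (intro zdvd_imp_le) auto
  finally show ?thesis
    using card_residue[OF k _ m_dvd[OF assms], of a] m_ge[OF assms(2)] by (simp add: residue_class_def)
qed

text \<open>The case \<open>r \<le> j\<close> serves the last orbit of the chain, whose successor
  class is empty.\<close>

lemma card_residue_class_self: "card (residue_class j (m j) a) \<le> 1"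
proof (cases "j < r")
  case True
  then show ?thesis using card_residue[of j "m j" a] m_ge[OF True] by (simp add: residue_class_def)
next
  case False
  then have "residue_class j (m j) a = {}" using class_less by (auto simp: residue_class_def)
  then show ?thesis by simp
qed

section \<open>Graphs whose automorphisms are the rotations\<close>

lemma not_dvd_small: "j < r \<Longrightarrow> 0 < b \<Longrightarrow> b < m j \<Longrightarrow> \<not> m j dvd b"
  using zdvd_imp_le[of "m j" b] by auto

text \<open>Degree separates the orbits: it is at least \<open>m 0\<close> on orbit 0 and at most
  \<open>3 * (m 0 div m 1) < m 0\<close> on orbit 1. The cyclic gaps of {0, 1, 3} are 1, 2 and
  \<open>m 1 - 4\<close>, pairwise distinct for \<open>m 1 \<ge> 7\<close>, and a reflection would
  reverse their cyclic order.\<close>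

lemma two_long_orbits_GR_2:
  assumes r: "r = 2" and m1: "7 \<le> m 1"
  shows "(rotations, V) \<in> GR 2"
proof -
  text \<open>The set \<open>{0, 1, 3}\<close> is not mapped to a translate of itself by negation.\<close>
  define L where "L u v \<longleftrightarrow> m 1 dvd x v - x u - 0 \<or> m 1 dvd x v - x u - 1 \<or> m 1 dvd x v - x u - 3" for u v
  define R where "R u v \<longleftrightarrow> c u = 0 \<and> c v = 0 \<and> \<not> adjacent_in_cycle u v \<or> c u = 0 \<and> c v = 1 \<and> L u v" for u v
  define W where "W u v = (of_bool (R u v \<or> R v u) :: nat)" for u v
  have r1: "1 < r" using r by simp
  have coc: "cocycle W"
    by (auto simp: cocycle_def W_def R_def adjacent_in_cycle_sym)
  have W01: "W u v = of_bool (L u v)" if "c u = 0" "c v = 1" for u v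
    using that by (auto simp: W_def R_def)
  have cls: "c v = 0 \<or> c v = 1" if "v \<in> V" for v
    using class_less[OF that] r by auto
  have m10: "m 1 dvd m 0" using m_dvd[of 0 1] r by simp
  have big: "m 0 \<le> degree W v" if v: "v \<in> V" "c v = 0" for v
  proof -
    let ?T = "{vertex 1 (x v), vertex 1 (x v + 1), vertex 1 (x v + 3)}"
    have "\<not> m 1 dvd 1" "\<not> m 1 dvd 2" "\<not> m 1 dvd 3"
      using not_dvd_small[OF r1] m1 by auto
    then have "vertex 1 (x v) \<noteq> vertex 1 (x v + 1)" "vertex 1 (x v) \<noteq> vertex 1 (x v + 3)"
        "vertex 1 (x v + 1) \<noteq> vertex 1 (x v + 3)"
      by (simp_all add: vertex_eq_iff[OF r1])
    then have "card ?T = 3" by simp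
    moreover have "W v (vertex 1 (x v + s)) = 1" if "s \<in> {0, 1, 3}" for s
      using vertex[OF r1, of "x v + s"] v that by (auto simp: W01 L_def diff_diff_eq)
    from this[of 0] this[of 1] this[of 3] have "m 0 - 3 + int (card ?T) \<le> degree W v"
      using vertex[OF r1] by (intro degree_ge coc v) auto
    ultimately show ?thesis by simp
  qed
  have small: "degree W v < m 0" if v: "v \<in> V" "c v = 1" for v
  proof -
    let ?Z = "residue_class 0 (m 1)"
    have "{w \<in> V. w \<noteq> v \<and> W v w = 1} \<subseteq> ?Z (x v) \<union> ?Z (x v - 1) \<union> ?Z (x v - 3)"
      using v by (auto simp: W_def R_def L_def residue_class_def dvd_flip[of _ "x v"] dvd_diff_commute[of _ "x v"])
    then have "card {w \<in> V. w \<noteq> v \<and> W v w = 1} \<le> card (?Z (x v) \<union> ?Z (x v - 1) \<union> ?Z (x v - 3))"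
      by (intro card_mono) auto
    also have "\<dots> \<le> card (?Z (x v)) + card (?Z (x v - 1)) + card (?Z (x v - 3))"
      by (meson add_mono card_Un_le le_refl le_trans)
    finally have "degree W v \<le> int (card (?Z (x v))) + int (card (?Z (x v - 1))) + int (card (?Z (x v - 3)))"
      unfolding degree_def by linarith
    also have "\<dots> = 3 * (m 0 div m 1)"
      using card_residue[OF r_pos _ m10] m1 by (simp add: residue_class_def)
    also have "\<dots> < m 1 * (m 0 div m 1)"
    proof (rule mult_strict_right_mono)
      have "m 1 \<le> m 0" using m_0_ge by (intro zdvd_imp_le m10) simp
      then show "0 < m 0 div m 1" using m1 by (simp add: pos_imp_zdiv_pos_iff)
    qed (use m1 in simp)
    finally show ?thesis using m10 by simp
  qed
  have class0_iff: "c v = 0 \<longleftrightarrow> m 0 \<le> degree W v" if "v \<in> V" for v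
    using big[OF that] small[OF that] cls[OF that] by auto
  show ?thesis
  proof (rule rotations_in_GR[of W])
    show "W u v = W v u" "W u v < 2" for u v by (auto simp: W_def)
  next
    fix f assume f: "f \<in> rotations"
    have "R (f u) (f v) \<longleftrightarrow> R u v" if "u \<in> V" "v \<in> V" for u v
      using rotation_adjacent_in_cycle[OF f that] rotation_dvd_iff[OF f that(2,1), of "m 1"]
        rotation_dvd_iff_0[OF f that(2,1), of "m 1"] m10
      by (auto simp: R_def L_def rotation_class[OF f] that)
    then show "preserves W f" using rotation_permutes[OF f] by (simp add: preserves_def W_def)
  next
    fix f assume f: "preserves W f"
    have class0: "c (f v) = 0 \<longleftrightarrow> c v = 0" if "v \<in> V" for v
      using class0_iff[OF that] class0_iff[of "f v"] degree_preserved[OF f that]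
        preserves_in[OF f, of v] that by simp
    have fc: "c (f v) = c v" if "v \<in> V" for v
      using class0[OF that] cls[OF that] cls[of "f v"] preserves_in[OF f, of v] that by auto
    obtain \<epsilon> t where \<epsilon>: "\<epsilon> = 1 \<or> \<epsilon> = -1"
        "\<And>v. v \<in> V \<Longrightarrow> c v = 0 \<Longrightarrow> m 0 dvd x (f v) - (t + \<epsilon> * x v)"
      by (rule cocycle_automorphism[OF coc f]) (use class0 in auto)
    \<comment> \<open>The vertex \<open>u\<close> below is the neighbour of \<open>v\<close> at
      difference \<open>s\<close>; its image is a neighbour of \<open>f v\<close>, at a difference
      \<open>s'\<close> that need not be \<open>s\<close> a priori.\<close>
    have image: "\<exists>s'\<in>{0, 1, 3}. m 1 dvd x (f v) - (t + \<epsilon> * (x v - s)) - s'"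
      if v: "v \<in> V" "c v = 1" and s: "s \<in> {0, 1, 3}" for v s
    proof -
      define u where "u = vertex 0 (x v - s)"
      have u: "u \<in> V" "c u = 0" "m 0 dvd x u - (x v - s)"
        using vertex[OF r_pos] by (simp_all add: u_def)
      have "u \<noteq> v" using u v by auto
      have u1: "m 1 dvd x u - (x v - s)" using u(3) m10 dvd_trans by blast
      then have "W u v = 1"
        using s u v by (auto simp: W01 L_def dvd_flip[of _ "x v"] dvd_diff_commute[of _ "x v"])
      then have "L (f u) (f v)"
        using preserves_eq[OF f u(1) v(1)] \<open>u \<noteq> v\<close> u v fc by (simp add: W01)
      then have "\<exists>s'\<in>{0, 1, 3}. m 1 dvd x (f v) - x (f u) - s'"
        by (simp add: L_def)
      then show ?thesis
        using affine_transfer[OF m10 \<epsilon>(2)[OF u(1,2)] _ u1] by blast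
    qed
    have shift: "\<epsilon> = 1 \<and> m 1 dvd x (f v) - (x v + t)" if v: "v \<in> V" "c v = 1" for v
    proof -
      have no: "\<not> m 1 dvd 2" "\<not> m 1 dvd 3" "\<not> m 1 dvd 4" "\<not> m 1 dvd 5" "\<not> m 1 dvd 6"
          "\<bar>m 1\<bar> \<noteq> 1"
        using not_dvd_small[OF r1] m1 by auto
      \<comment> \<open>\<open>e\<close> measures how far \<open>f v\<close> deviates from the
        affine map that \<open>f\<close> induces on orbit 0. Modulo \<open>m 1\<close>, each of
        \<open>e\<close>, \<open>e + \<epsilon>\<close> and \<open>e + 3 * \<epsilon>\<close> lies
        in {0, 1, 3}.\<close>
      define e where "e = x (f v) - (t + \<epsilon> * x v)"
      have ss: "\<exists>s'\<in>{0, 1, 3}. m 1 dvd e + \<epsilon> * s - s'" if "s \<in> {0, 1, 3}" for s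
        using image[OF v that] by (simp add: e_def algebra_simps)
      have "\<exists>s'\<in>{0, 1, 3}. m 1 dvd e - s'"
        using ss[of 0] by simp
      then obtain s0 where s0: "s0 \<in> {0, 1, 3}" "m 1 dvd e - s0"
        by blast
      have sub: "\<exists>s'\<in>{0, 1, 3}. m 1 dvd s0 + \<epsilon> * s - s'" if s: "s \<in> {0, 1, 3}" for s
      proof -
        obtain s' where s': "s' \<in> {0, 1, 3}" "m 1 dvd e + \<epsilon> * s - s'" using ss[OF s] by blast
        from dvd_diff[OF s'(2) s0(2)] have "m 1 dvd s0 + \<epsilon> * s - s'" by (simp add: algebra_simps)
        then show ?thesis using s'(1) by blast
      qed
      \<comment> \<open>In the other five of the six cases for \<open>\<epsilon>\<close> and
        \<open>s0\<close>, one of \<open>s0 + \<epsilon>\<close> and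
        \<open>s0 + 3 * \<epsilon>\<close> falls outside {0, 1, 3} modulo \<open>m 1\<close>. All
        differences that occur are at most 6 in absolute value.\<close>
      have "\<epsilon> = 1 \<and> s0 = 0"
        using \<epsilon>(1) s0(1) sub[of 1] sub[of 3] by (auto simp: no)
      then show ?thesis using s0(2) by (simp add: e_def algebra_simps)
    qed
    have "\<epsilon> = 1" using shift[of "vertex 1 0"] vertex[OF r1] by blast
    then have "m (c v) dvd x (f v) - (x v + t)" if "v \<in> V" for v
      using \<epsilon>(2)[OF that] shift[OF that] cls[OF that] by (auto simp: algebra_simps)
    then show "f \<in> rotations"
      using fc preserves_permutes[OF f] by (auto simp: rotations_def)
  qed
qed

text \<open>The differences 0 and 1 between the orbits get the distinct colors 1 and 2, so each is
  preserved separately. A map \<open>d \<mapsto> a - d\<close> fixing both would make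
  \<open>m 1\<close> divide 2.\<close>

lemma two_orbits_GR_3:
  assumes r: "r = 2"
  shows "(rotations, V) \<in> GR 3"
proof -
  define W where "W u v = (if c u = 0 \<and> c v = 0 then of_bool (\<not> adjacent_in_cycle u v)
     else if c u \<noteq> c v \<and> m 1 dvd x u - x v - 0 then 1
     else if c u = 0 \<and> c v \<noteq> 0 \<and> m 1 dvd x v - x u - 1 \<or>
             c v = 0 \<and> c u \<noteq> 0 \<and> m 1 dvd x u - x v - 1 then 2 else (0::nat))" for u v
  have r1: "1 < r" using r by simp
  have coc: "cocycle W"
    by (auto simp: cocycle_def W_def)
  have cls: "c v = 0 \<or> c v = 1" if "v \<in> V" for v
    using class_less[OF that] r by auto
  have m10: "m 1 dvd m 0" using m_dvd[of 0 1] r by simp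
  have no: "\<not> m 1 dvd 1" "\<not> m 1 dvd 2"
    using not_dvd_small[OF r1] m_ge[OF r1] by auto
  \<comment> \<open>Degrees count color 1 only, and a vertex of orbit 0 has exactly one such
    neighbour in orbit 1.\<close>
  have big: "m 0 - 2 \<le> degree W v" if v: "v \<in> V" "c v = 0" for v
  proof -
    have "m 1 dvd x v - x (vertex 1 (x v))"
      using vertex(3)[OF r1, of "x v"] by (simp add: dvd_diff_commute)
    then have "m 0 - 3 + int (card {vertex 1 (x v)}) \<le> degree W v"
      using vertex[OF r1, of "x v"] v by (intro degree_ge coc v) (auto simp: W_def)
    then show ?thesis by simp
  qed
  have small: "degree W v < m 0 - 2" if v: "v \<in> V" "c v = 1" for v
  proof -
    have "w \<in> residue_class 0 (m 1) (x v)" if "w \<in> V" "W v w = 1" for w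
      using v cls that by (auto simp: W_def residue_class_def dvd_diff_commute[of _ "x v"] split: if_splits)
    then have "card {w \<in> V. w \<noteq> v \<and> W v w = 1} \<le> card (residue_class 0 (m 1) (x v))"
      by (intro card_mono) auto
    then show ?thesis
      using card_residue_class_le[of 0 1 "x v"] m_0_ge r by (simp add: degree_def)
  qed
  have class0_iff: "c v = 0 \<longleftrightarrow> m 0 - 2 \<le> degree W v" if "v \<in> V" for v
    using big[OF that] small[OF that] cls[OF that] by auto
  show ?thesis
  proof (rule rotations_in_GR[of W])
    have "m 1 dvd x u - x v \<longleftrightarrow> m 1 dvd x v - x u" for u v
      by (rule dvd_diff_commute)
    then show "W u v = W v u" "W u v < 3" for u v
      by (auto simp: W_def adjacent_in_cycle_sym)
  next
    fix f assume f: "f \<in> rotations"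
    have "W (f u) (f v) = W u v" if "u \<in> V" "v \<in> V" for u v
    proof -
      have "m 1 dvd m (c w)" if "w \<in> V" for w using cls[OF that] m10 by auto
      from this[OF that(1)] this[OF that(2)] show ?thesis
        using rotation_adjacent_in_cycle[OF f that] rotation_dvd_iff[OF f that, of "m 1"]
          rotation_dvd_iff[OF f that(2,1), of "m 1"] rotation_dvd_iff_0[OF f that, of "m 1"]
          rotation_dvd_iff_0[OF f that(2,1), of "m 1"]
        by (simp add: W_def rotation_class[OF f] that)
    qed
    then show "preserves W f" using rotation_permutes[OF f] by (simp add: preserves_def)
  next
    fix f assume f: "preserves W f"
    have class0: "c (f v) = 0 \<longleftrightarrow> c v = 0" if "v \<in> V" for v
      using class0_iff[OF that] class0_iff[of "f v"] degree_preserved[OF f that]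
        preserves_in[OF f, of v] that by simp
    have fc: "c (f v) = c v" if "v \<in> V" for v
      using class0[OF that] cls[OF that] cls[of "f v"] preserves_in[OF f, of v] that by auto
    obtain \<epsilon> t where \<epsilon>: "\<epsilon> = 1 \<or> \<epsilon> = -1"
        "\<And>v. v \<in> V \<Longrightarrow> c v = 0 \<Longrightarrow> m 0 dvd x (f v) - (t + \<epsilon> * x v)"
      by (rule cocycle_automorphism[OF coc f]) (use class0 in auto)
    \<comment> \<open>Between the orbits each nonzero color occurs at only one difference, so the
      difference \<open>s\<close> itself is preserved.\<close>
    have image: "m 1 dvd x (f v) - (t + \<epsilon> * (x v - s)) - s"
      if v: "v \<in> V" "c v = 1" and s: "s \<in> {0, 1}" for v s
    proof -
      define u where "u = vertex 0 (x v - s)"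
      have u: "u \<in> V" "c u = 0" "m 0 dvd x u - (x v - s)"
        using vertex[OF r_pos] by (simp_all add: u_def)
      have "u \<noteq> v" using u v by auto
      have u1: "m 1 dvd x u - (x v - s)" using u(3) m10 dvd_trans by blast
      then have u2: "m 1 dvd x v - x u - s" by (simp add: dvd_flip)
      have W01: "W a b = (if m 1 dvd x b - x a - 0 then 1 else if m 1 dvd x b - x a - 1 then 2 else 0)"
        if "c a = 0" "c b = 1" for a b
        using that by (simp add: W_def dvd_diff_commute[of "m 1" "x a"])
      have "s = 0 \<or> s = 1 \<and> \<not> m 1 dvd x v - x u"
      proof -
        have False if "s = 1" "m 1 dvd x v - x u"
          using dvd_diff[OF that(2) u2] that(1) no by simp
        then show ?thesis using s by auto
      qed
      then have "W u v = (if s = 0 then 1 else 2)"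
        using u v u2 by (auto simp: W01)
      then have "W (f u) (f v) = (if s = 0 then 1 else 2)"
        using preserves_eq[OF f u(1) v(1)] \<open>u \<noteq> v\<close> by simp
      moreover have "c (f u) = 0" "c (f v) = 1" using fc u v by simp_all
      note W01[OF this]
      ultimately have "m 1 dvd x (f v) - x (f u) - s"
        using s by (auto split: if_splits)
      then show ?thesis
        using affine_transfer[OF m10 \<epsilon>(2)[OF u(1,2)] _ u1] by blast
    qed
    have shift: "\<epsilon> = 1 \<and> m 1 dvd x (f v) - (x v + t)" if v: "v \<in> V" "c v = 1" for v
    proof -
      \<comment> \<open>The conditions for \<open>s = 0\<close> and \<open>s = 1\<close> differ by
        \<open>1 - \<epsilon>\<close>, which would be 2 for a reflection.\<close>
      have "m 1 dvd x (f v) - (t + \<epsilon> * x v)" "m 1 dvd x (f v) - (t + \<epsilon> * (x v - 1)) - 1"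
        using image[OF v, of 0] image[OF v, of 1] by simp_all
      from dvd_diff[OF this] have "m 1 dvd 1 - \<epsilon>" by (simp add: algebra_simps)
      then have "\<epsilon> = 1" using \<epsilon>(1) no by auto
      then show ?thesis using image[OF v, of 0] by (simp add: algebra_simps)
    qed
    have "\<epsilon> = 1" using shift[of "vertex 1 0"] vertex[OF r1] by blast
    then have "m (c v) dvd x (f v) - (x v + t)" if "v \<in> V" for v
      using \<epsilon>(2)[OF that] shift[OF that] cls[OF that] by (auto simp: algebra_simps)
    then show "f \<in> rotations"
      using fc preserves_permutes[OF f] by (auto simp: rotations_def)
  qed
qed

text \<open>An automorphism is first shown to preserve every orbit: orbit 0 by degree, orbits 1 and
  2 by the number of neighbours in orbit 0, each later orbit by adjacency to the preceding one. Then
  the triangle excludes reflections and the chain carries the shift from orbit 2 onwards.\<close>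

lemma three_orbits_GR_2:
  assumes r: "3 \<le> r"
  shows "(rotations, V) \<in> GR 2"
proof -
  \<comment> \<open>The last clause provides both the third side of the triangle, from orbit 1 to
    orbit 2, and the chain beyond it.\<close>
  define R where "R u v \<longleftrightarrow> c u = 0 \<and> c v = 0 \<and> \<not> adjacent_in_cycle u v \<or>
      c u = 0 \<and> c v = 1 \<and> (m 1 dvd x v - x u \<or> m 1 dvd x v - x u - 1) \<or>
      c u = 0 \<and> c v = 2 \<and> m 2 dvd x v - x u \<or>
      1 \<le> c u \<and> c v = c u + 1 \<and> m (c v) dvd x v - x u" for u v
  define W where "W u v = (of_bool (R u v \<or> R v u) :: nat)" for u v
  have r1: "1 < r" and r2: "2 < r" using r by simp_all
  have coc: "cocycle W"
    by (auto simp: cocycle_def W_def R_def adjacent_in_cycle_sym)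
  have W_sym: "W u v = W v u" for u v by (auto simp: W_def)
  have W01: "W u v = 1 \<longleftrightarrow> m 1 dvd x v - x u \<or> m 1 dvd x v - x u - 1" if "c u = 0" "c v = 1" for u v
    using that by (simp add: W_def R_def)
  have W02: "W u v = of_bool (m 2 dvd x v - x u)" if "c u = 0" "c v = 2" for u v
    using that by (simp add: W_def R_def)
  have W0: "W v u = 0" if "c u = 0" "3 \<le> c v" for u v
    using that by (simp add: W_def R_def)
  have W_Suc: "W u v = of_bool (m (c v) dvd x v - x u)" if "1 \<le> c u" "c v = c u + 1" for u v
    using that by (simp add: W_def R_def)
  have W_far: "W u v = 0" if "1 \<le> c u" "1 \<le> c v" "c v \<noteq> c u + 1" "c u \<noteq> c v + 1" for u v
    using that by (simp add: W_def R_def)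
  have m10: "m 1 dvd m 0" and m20: "m 2 dvd m 0" and m21: "m 2 dvd m 1"
    using m_dvd[of 0 1] m_dvd[of 0 2] m_dvd[of 1 2] r by simp_all
  have no: "\<not> m 1 dvd 1" "\<not> m 1 dvd 2" "\<not> m 2 dvd 1"
    using not_dvd_small[OF r1] not_dvd_small[OF r2] m_ge[OF r1] m_ge[OF r2] by auto
  have big: "m 0 \<le> degree W v" if v: "v \<in> V" "c v = 0" for v
  proof -
    let ?T = "{vertex 1 (x v), vertex 1 (x v + 1), vertex 2 (x v)}"
    have "vertex 1 (x v) \<noteq> vertex 1 (x v + 1)"
      using no by (simp add: vertex_eq_iff[OF r1])
    moreover have "vertex 1 a \<noteq> vertex 2 b" for a b
      using vertex(2)[OF r1, of a] vertex(2)[OF r2, of b] by auto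
    ultimately have "card ?T = 3" by simp
    moreover have "W v (vertex 1 (x v)) = 1" "W v (vertex 1 (x v + 1)) = 1" "W v (vertex 2 (x v)) = 1"
      using v vertex[OF r1, of "x v"] vertex[OF r1, of "x v + 1"] vertex[OF r2, of "x v"]
      by (simp_all add: W01 W02 diff_diff_eq)
    then have "m 0 - 3 + int (card ?T) \<le> degree W v"
      using vertex[OF r1] vertex[OF r2] by (intro degree_ge coc v) auto
    ultimately show ?thesis by simp
  qed
  have class1: "W v w = 1 \<longleftrightarrow> w \<in> residue_class 0 (m 1) (x v) \<union> residue_class 0 (m 1) (x v - 1)"
    if "w \<in> V" "v \<in> V" "c w = 0" "c v = 1" for v w
    using that by (auto simp: W_sym[of v w] W01 residue_class_def dvd_flip[of _ "x v"] dvd_diff_commute[of _ "x v"])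
  have class2: "W v w = 1 \<longleftrightarrow> w \<in> residue_class 0 (m 2) (x v)"
    if "w \<in> V" "v \<in> V" "c w = 0" "c v = 2" for v w
    using that by (auto simp: W_sym[of v w] W02 residue_class_def dvd_diff_commute[of _ "x v"])
  have up: "w \<in> residue_class (c v + 1) (m (c v + 1)) (x v)"
    if "w \<in> V" "v \<in> V" "1 \<le> c v" "c w = c v + 1" "W v w = 1" for v w
    using that by (simp add: W_Suc residue_class_def)
  have down: "w \<in> residue_class i (m (c v)) (x v)"
    if "w \<in> V" "v \<in> V" "1 \<le> i" "c w = i" "c v = i + 1" "W v w = 1" for v w i
    using that by (simp add: W_sym[of v w] W_Suc residue_class_def dvd_diff_commute[of _ "x v"])
  have small: "degree W v < m 0" if v: "v \<in> V" "c v \<noteq> 0" for v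
  proof -
    \<comment> \<open>The neighbours of \<open>v\<close> lie in two sets of at most
      \<open>m 0 / 3\<close> vertices each and in one class of at most one vertex, and
      \<open>2 * m 0 / 3 + 1 < m 0\<close>.\<close>
    have *: ?thesis if "\<And>w. w \<in> V \<Longrightarrow> W v w = 1 \<Longrightarrow> w \<in> A \<union> B \<union> residue_class j (m j) a" "finite A" "finite B"
      "3 * int (card A) \<le> m 0" "3 * int (card B) \<le> m 0" for A B :: "'a set" and a j
    proof -
      have "card {w \<in> V. w \<noteq> v \<and> W v w = 1} \<le> card (A \<union> B \<union> residue_class j (m j) a)"
        using that by (intro card_mono) auto
      also have "\<dots> \<le> card A + card B + card (residue_class j (m j) a)"
        by (meson add_mono card_Un_le le_refl le_trans)
      finally have "degree W v \<le> int (card A) + int (card B) + 1"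
        using card_residue_class_self[of j a] unfolding degree_def by linarith
      then show ?thesis using that(4,5) m_0_ge by linarith
    qed
    consider "c v = 1" | "c v = 2" | "3 \<le> c v" using v(2) by linarith
    then show ?thesis
    proof cases
      case 1
      show ?thesis
      proof (rule *)
        fix w assume w: "w \<in> V" "W v w = 1"
        have "c w = 0 \<or> c w = 2" using W_far[of v w] w 1 by (cases "c w = 0 \<or> c w = 2") auto
        then show "w \<in> residue_class 0 (m 1) (x v) \<union> residue_class 0 (m 1) (x v - 1) \<union>
            residue_class 2 (m 2) (x v)"
          using class1[OF w(1) v(1)] up[OF w(1) v(1)] 1 w by auto
      qed (use card_residue_class_le[of 0 1] r1 in simp_all)
    next
      case 2
      show ?thesis
      proof (rule *)
        fix w assume w: "w \<in> V" "W v w = 1"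
        have "c w = 0 \<or> c w = 1 \<or> c w = 3"
          using W_far[of v w] w 2 by (cases "c w = 0 \<or> c w = 1 \<or> c w = 3") auto
        then show "w \<in> residue_class 0 (m 2) (x v) \<union> residue_class 1 (m 2) (x v) \<union>
            residue_class 3 (m 3) (x v)"
          using class2[OF w(1) v(1)] up[OF w(1) v(1)] down[OF w(1) v(1), of 1] 2 w by auto
      qed (use card_residue_class_le[of 0 2] card_residue_class_le[of 1 2] r2 in simp_all)
    next
      case 3
      show ?thesis
      proof (rule *)
        fix w assume w: "w \<in> V" "W v w = 1"
        have "1 \<le> c w" using W0[of w v] 3 w by (cases "c w = 0") simp_all
        then have "c w = c v + 1 \<or> c v = c w + 1"
          using W_far[of v w] w 3 by (cases "c w = c v + 1 \<or> c v = c w + 1") auto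
        then show "w \<in> residue_class (c v - 1) (m (c v)) (x v) \<union> {} \<union>
            residue_class (c v + 1) (m (c v + 1)) (x v)"
          using up[OF w(1) v(1)] down[OF w(1) v(1), of "c v - 1"] \<open>1 \<le> c w\<close> 3 w by auto
      qed (use card_residue_class_le[of "c v - 1" "c v"] class_less[OF v(1)] m_0_ge in simp_all)
    qed
  qed
  have class0_iff: "c v = 0 \<longleftrightarrow> m 0 \<le> degree W v" if "v \<in> V" for v
    using big[OF that] small[OF that] by (cases "c v = 0") simp_all

  text \<open>The parity of the number of neighbours in orbit \<open>0\<close> tells orbits \<open>1\<close> and \<open>2\<close> apart.\<close>
  define n0 where "n0 v = card {w \<in> V. w \<noteq> v \<and> c w = 0 \<and> W v w = 1}" for v
  \<comment> \<open>Orbit lengths are odd, hence so are their quotients. A vertex of orbit 2 sees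
    one residue class in orbit 0, of odd size; a vertex of orbit 1 sees two disjoint ones of equal
    size.\<close>
  have odd_index: "odd (m 0 div m j)" if "j < r" for j
  proof -
    have "odd (m j * (m 0 div m j))" using m_odd[OF r_pos] m_dvd[of 0 j] that by simp
    then show ?thesis by simp
  qed
  have n0_1: "even (n0 v) \<and> n0 v \<noteq> 0" if v: "v \<in> V" "c v = 1" for v
  proof -
    let ?A = "residue_class 0 (m 1) (x v)" and ?B = "residue_class 0 (m 1) (x v - 1)"
    have "{w \<in> V. w \<noteq> v \<and> c w = 0 \<and> W v w = 1} = ?A \<union> ?B"
      using class1[OF _ v(1) _ v(2)] v by (auto simp: residue_class_def)
    moreover have "?A \<inter> ?B = {}"
    proof (rule ccontr)
      assume "?A \<inter> ?B \<noteq> {}"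
      then obtain w where "m 1 dvd x w - x v" "m 1 dvd x w - (x v - 1)"
        by (auto simp: residue_class_def)
      from dvd_diff[OF this(2,1)] show False using no by simp
    qed
    ultimately have "int (n0 v) = int (card ?A) + int (card ?B)"
      by (simp add: n0_def card_Un_disjoint)
    also have "\<dots> = 2 * (m 0 div m 1)"
      using card_residue[OF r_pos _ m10] m_ge[OF r1] by (simp add: residue_class_def)
    finally have n0: "int (n0 v) = 2 * (m 0 div m 1)" .
    have "even (int (n0 v))" unfolding n0 by simp
    then have "even (n0 v)" by simp
    moreover have "m 0 div m 1 \<noteq> 0" using odd_index[OF r1] by auto
    ultimately show ?thesis using n0 by auto
  qed
  have n0_2: "odd (n0 v)" if v: "v \<in> V" "c v = 2" for v
  proof -
    have "w \<noteq> v \<and> c w = 0 \<and> W v w = 1 \<longleftrightarrow> w \<in> residue_class 0 (m 2) (x v)" if "w \<in> V" for w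
      using class2[OF that v(1) _ v(2)] v by (auto simp: residue_class_def)
    then have "{w \<in> V. w \<noteq> v \<and> c w = 0 \<and> W v w = 1} = residue_class 0 (m 2) (x v)"
      by (auto simp: residue_class_def)
    then have "int (n0 v) = m 0 div m 2"
      using card_residue[OF r_pos _ m20] m_ge[OF r2] by (simp add: residue_class_def n0_def)
    then have "odd (int (n0 v))" using odd_index[OF r2] by simp
    then show ?thesis by simp
  qed
  have n0_3: "n0 v = 0" if v: "v \<in> V" "3 \<le> c v" for v
  proof -
    have "{w \<in> V. w \<noteq> v \<and> c w = 0 \<and> W v w = 1} = {}"
      using W0[OF _ v(2)] by auto
    then show ?thesis by (simp only: n0_def card.empty)
  qed
  \<comment> \<open>Being nonzero distinguishes the count in orbit 1 from that in orbits 3 and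
    later, which have no edges to orbit 0.\<close>
  have class1_iff: "c v = 1 \<longleftrightarrow> even (n0 v) \<and> n0 v \<noteq> 0"
    and class2_iff: "c v = 2 \<longleftrightarrow> odd (n0 v)" if v: "v \<in> V" "c v \<noteq> 0" for v
  proof -
    consider "c v = 1" | "c v = 2" | "3 \<le> c v" using v(2) by linarith
    then have "(c v = 1 \<longleftrightarrow> even (n0 v) \<and> n0 v \<noteq> 0) \<and> (c v = 2 \<longleftrightarrow> odd (n0 v))"
      by cases (use n0_1 n0_2 n0_3 v in auto)
    then show "c v = 1 \<longleftrightarrow> even (n0 v) \<and> n0 v \<noteq> 0" "c v = 2 \<longleftrightarrow> odd (n0 v)" by blast+
  qed
  \<comment> \<open>Beyond orbit \<open>i\<close>, only orbit \<open>i + 1\<close> has edges to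
    orbit \<open>i\<close>. This identifies the orbits from number 3 on, one after another.\<close>
  have class_Suc_iff: "c v = i + 1 \<longleftrightarrow> (\<exists>u\<in>V. u \<noteq> v \<and> c u = i \<and> W u v = 1)"
    if v: "v \<in> V" "i < c v" and i: "2 \<le> i" for v i
  proof
    assume cv: "c v = i + 1"
    have ir: "i < r" "i + 1 < r" using class_less[OF v(1)] cv by simp_all
    have "m (i + 1) dvd x (vertex i (x v)) - x v"
      using vertex(3)[OF ir(1)] m_dvd[of i "i + 1"] ir dvd_trans by auto
    then have "W (vertex i (x v)) v = 1"
      using vertex(2)[OF ir(1)] cv i by (simp add: W_Suc dvd_diff_commute[of _ "x v"])
    moreover have "vertex i (x v) \<noteq> v" using vertex(2)[OF ir(1), of "x v"] cv by auto
    ultimately show "\<exists>u\<in>V. u \<noteq> v \<and> c u = i \<and> W u v = 1"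
      using vertex[OF ir(1), of "x v"] by blast
  next
    assume "\<exists>u\<in>V. u \<noteq> v \<and> c u = i \<and> W u v = 1"
    then obtain u where "c u = i" "W u v = 1" by blast
    then show "c v = i + 1" using W_far[of u v] v i by (cases "c v = i + 1") auto
  qed
  show ?thesis
  proof (rule rotations_in_GR[of W])
    show "W u v = W v u" "W u v < 2" for u v by (auto simp: W_def)
  next
    fix f assume f: "f \<in> rotations"
    have "R (f u) (f v) \<longleftrightarrow> R u v" if uv: "u \<in> V" "v \<in> V" for u v
    proof -
      note dvd_iff = rotation_dvd_iff[OF f uv(2,1)] rotation_dvd_iff_0[OF f uv(2,1)]
      have "m (c v) dvd m (c u)" if "c u \<le> c v"
        using m_dvd[OF that class_less[OF uv(2)]] .
      then show ?thesis
        using rotation_adjacent_in_cycle[OF f uv] dvd_iff[of "m 1"] dvd_iff[of "m 2"] dvd_iff[of "m (c v)"] m10 m20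
        by (auto simp: R_def rotation_class[OF f] uv)
    qed
    then show "preserves W f" using rotation_permutes[OF f] by (simp add: preserves_def W_def)
  next
    fix f assume f: "preserves W f"
    have fV: "f v \<in> V" if "v \<in> V" for v
      using preserves_in[OF f] that by simp
    have class0: "c (f v) = 0 \<longleftrightarrow> c v = 0" if "v \<in> V" for v
      using class0_iff[OF that] class0_iff[OF fV[OF that]] degree_preserved[OF f that] by simp
    have n0: "n0 (f v) = n0 v" if "v \<in> V" for v
      unfolding n0_def by (rule card_neighbours_preserved[OF f that]) (use class0 in simp)
    \<comment> \<open>The induction hypothesis makes all orbits before \<open>j\<close> invariant,
      so that for \<open>j \<ge> 3\<close> adjacency to orbit \<open>j - 1\<close> becomes an
      invariant property.\<close>
    have "\<forall>v\<in>V. c (f v) = j \<longleftrightarrow> c v = j" for j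
    proof (induction j rule: less_induct)
      case (less j)
      have "j = 0 \<or> j = 1 \<or> j = 2 \<or> j = (j - 1) + 1 \<and> 2 \<le> j - 1" by arith
      then consider "j = 0" | "j = 1" | "j = 2" | i where "j = i + 1" "2 \<le> i" by blast
      then show ?case
      proof cases
        case 4
        have "c (f v) = i + 1 \<longleftrightarrow> c v = i + 1" if v: "v \<in> V" for v
        proof (cases "i < c v")
          case False
          then have "c (f v) = c v" using less[of "c v"] 4(1) v by simp
          then show ?thesis by simp
        next
          case True
          have "i < c (f v)"
            using less[of "c (f v)"] 4(1) v True by (cases "i < c (f v)") auto
          have "(\<exists>u\<in>V. u \<noteq> f v \<and> c u = i \<and> W u (f v) = 1) \<longleftrightarrow>
              (\<exists>u\<in>f ` V. u \<noteq> f v \<and> c u = i \<and> W u (f v) = 1)"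
            by (simp add: permutes_image[OF preserves_permutes[OF f]])
          also have "\<dots> \<longleftrightarrow> (\<exists>u\<in>V. u \<noteq> v \<and> c u = i \<and> W u v = 1)"
          proof -
            have "(f u \<noteq> f v \<and> c (f u) = i \<and> W (f u) (f v) = 1) \<longleftrightarrow> (u \<noteq> v \<and> c u = i \<and> W u v = 1)"
              if u: "u \<in> V" for u
              using less[of i] 4(1) u preserves_eq[OF f u v]
                inj_eq[OF permutes_inj[OF preserves_permutes[OF f]]] by auto
            then show ?thesis by auto
          qed
          finally show ?thesis
            using class_Suc_iff[OF v True 4(2)] class_Suc_iff[OF fV[OF v] \<open>i < c (f v)\<close> 4(2)] by simp
        qed
        then show ?thesis using 4(1) by simp
      next
        case 2
        have "c (f v) = 1 \<longleftrightarrow> c v = 1" if v: "v \<in> V" for v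
          using class1_iff[OF v] class1_iff[OF fV[OF v]] class0[OF v] n0[OF v] by (cases "c v = 0") auto
        then show ?thesis using 2 by simp
      next
        case 3
        have "c (f v) = 2 \<longleftrightarrow> c v = 2" if v: "v \<in> V" for v
          using class2_iff[OF v] class2_iff[OF fV[OF v]] class0[OF v] n0[OF v] by (cases "c v = 0") auto
        then show ?thesis using 3 by simp
      qed (use class0 in simp)
    qed
    then have fc: "c (f v) = c v" if "v \<in> V" for v using that by blast
    obtain \<epsilon> t where \<epsilon>: "\<epsilon> = 1 \<or> \<epsilon> = -1"
        "\<And>v. v \<in> V \<Longrightarrow> c v = 0 \<Longrightarrow> m 0 dvd x (f v) - (t + \<epsilon> * x v)"
      by (rule cocycle_automorphism[OF coc f]) (use class0 in auto)
    have image1: "\<exists>s'\<in>{0, 1}. m 1 dvd x (f v) - (t + \<epsilon> * (x v - s)) - s'"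
      if v: "v \<in> V" "c v = 1" and s: "s \<in> {0, 1}" for v s
    proof -
      define u where "u = vertex 0 (x v - s)"
      have u: "u \<in> V" "c u = 0" "m 0 dvd x u - (x v - s)"
        using vertex[OF r_pos] by (simp_all add: u_def)
      have "u \<noteq> v" using u v by auto
      have u1: "m 1 dvd x u - (x v - s)" using u(3) m10 dvd_trans by blast
      then have "W u v = 1"
        using s u v by (auto simp: W01 dvd_flip[of _ "x v"] dvd_diff_commute[of _ "x v"])
      then have "W (f u) (f v) = 1"
        using preserves_eq[OF f u(1) v(1) \<open>u \<noteq> v\<close>] by simp
      then have "m 1 dvd x (f v) - x (f u) \<or> m 1 dvd x (f v) - x (f u) - 1"
        using W01[of "f u" "f v"] u v fc by simp
      then have "\<exists>s'\<in>{0, 1}. m 1 dvd x (f v) - x (f u) - s'" by simp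
      then show ?thesis
        using affine_transfer[OF m10 \<epsilon>(2)[OF u(1,2)] _ u1] by blast
    qed
    \<comment> \<open>A reflection must interchange the differences 0 and 1 between orbits 0 and 1,
      which displaces orbit 1 by one; the \<open>of_bool\<close> term is this displacement.\<close>
    have shift1: "m 1 dvd x (f v) - (t + \<epsilon> * x v) - of_bool (\<epsilon> = -1)" if v: "v \<in> V" "c v = 1" for v
    proof -
      define e where "e = x (f v) - (t + \<epsilon> * x v)"
      have "\<exists>s'\<in>{0, 1}. m 1 dvd e - s'"
        using image1[OF v, of 0] by (simp add: e_def)
      then obtain s0 where s0: "s0 \<in> {0, 1}" "m 1 dvd e - s0" by blast
      have "\<exists>s'\<in>{0, 1}. m 1 dvd e + \<epsilon> - s'"
        using image1[OF v, of 1] by (simp add: e_def algebra_simps)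
      then obtain s1 where s1: "s1 \<in> {0, 1}" "m 1 dvd e + \<epsilon> - s1" by blast
      from dvd_diff[OF s1(2) s0(2)] have "m 1 dvd s0 + \<epsilon> - s1" by (simp add: algebra_simps)
      then have "s0 = of_bool (\<epsilon> = -1)"
        using s0(1) s1(1) \<epsilon>(1) no dvd_minus_iff[of "m 1" 1] dvd_minus_iff[of "m 1" 2] by auto
      then show ?thesis using s0(2) by (simp add: e_def)
    qed
    have shift2: "m 2 dvd x (f v) - (t + \<epsilon> * x v)" if v: "v \<in> V" "c v = 2" for v
    proof -
      define u where "u = vertex 0 (x v)"
      have u: "u \<in> V" "c u = 0" "m 0 dvd x u - x v"
        using vertex[OF r_pos] by (simp_all add: u_def)
      have "u \<noteq> v" using u v by auto
      have u1: "m 2 dvd x u - x v" using u(3) m20 dvd_trans by blast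
      then have "W u v = 1"
        using u v by (simp add: W02 dvd_diff_commute[of _ "x v"])
      then have "m 2 dvd x (f v) - x (f u) - 0"
        using preserves_eq[OF f u(1) v(1)] \<open>u \<noteq> v\<close> u v fc by (simp add: W02)
      from affine_transfer[OF m20 \<epsilon>(2)[OF u(1,2)] this u1] show ?thesis by simp
    qed
    \<comment> \<open>For \<open>\<epsilon> = -1\<close>, orbit 1 is displaced by one while orbit 2
      is not, but the edges of difference 0 between these two orbits require equal displacements
      modulo \<open>m 2\<close>.\<close>
    have "\<epsilon> = 1"
    proof (rule ccontr)
      assume "\<epsilon> \<noteq> 1"
      then have \<epsilon>': "\<epsilon> = -1" using \<epsilon>(1) by simp
      define v where "v = vertex 1 0"
      define w where "w = vertex 2 (x v)"
      have v: "v \<in> V" "c v = 1" using vertex[OF r1] by (simp_all add: v_def)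
      have w: "w \<in> V" "c w = 2" "m 2 dvd x w - x v" using vertex[OF r2] by (simp_all add: w_def)
      have "v \<noteq> w" using v w by auto
      have "W v w = 1" using v w by (simp add: W_Suc)
      then have 1: "m 2 dvd x (f w) - x (f v)"
        using preserves_eq[OF f v(1) w(1) \<open>v \<noteq> w\<close>] v w fc by (simp add: W_Suc)
      have 2: "m 2 dvd x (f v) - (t - x v) - 1"
        using dvd_trans[OF m21 shift1[OF v]] \<epsilon>' by simp
      have 3: "m 2 dvd x (f w) - (t - x w)"
        using shift2[OF w(1,2)] \<epsilon>' by simp
      from dvd_diff[OF dvd_diff[OF dvd_diff[OF 3 2] 1] w(3)] show False
        using no by simp
    qed
    \<comment> \<open>Orbits 0, 1 and 2 share the shift \<open>t\<close>; edges of difference 0 pass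
      it on along the chain.\<close>
    have "m j dvd x (f v) - (t + 1 * x v)" if "v \<in> V" "c v = j" for v j
      using that
    proof (induction j arbitrary: v rule: less_induct)
      case (less j)
      have "j = 0 \<or> j = 1 \<or> j = 2 \<or> j = (j - 1) + 1 \<and> 2 \<le> j - 1" by arith
      then consider "j = 0" | "j = 1" | "j = 2" | i where "j = i + 1" "2 \<le> i" by blast
      then show ?case
      proof cases
        case 4
        have ir: "i < r" "i + 1 < r" using class_less[OF less.prems(1)] less.prems(2) 4 by simp_all
        have mi: "m j dvd m i" using m_dvd[of i j] ir 4 by simp
        define u where "u = vertex i (x v)"
        have u: "u \<in> V" "c u = i" "m i dvd x u - x v"
          using vertex[OF ir(1)] by (simp_all add: u_def)
        have "u \<noteq> v" using u less.prems 4 by auto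
        have u1: "m j dvd x u - x v" using u(3) mi dvd_trans by blast
        then have "W u v = 1"
          using u less.prems 4 by (simp add: W_Suc dvd_diff_commute[of _ "x v"])
        then have "m j dvd x (f v) - x (f u) - 0"
          using preserves_eq[OF f u(1) less.prems(1)] \<open>u \<noteq> v\<close> u less.prems fc 4 by (simp add: W_Suc)
        moreover have "m i dvd x (f u) - (t + 1 * x u)"
          using less.IH[of i u] u 4 by simp
        ultimately show ?thesis using affine_transfer[OF mi _ _ u1] by fastforce
      qed (use \<epsilon>(2) shift1 shift2 less.prems \<open>\<epsilon> = 1\<close> in auto)
    qed
    then show "f \<in> rotations"
      using fc preserves_permutes[OF f] by (auto simp: rotations_def add.commute)
  qed
qed

end

section \<open>Reflections\<close>

text \<open>A set of at most two residues \<open>i\<close> and \<open>j\<close> is preserved by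
  \<open>d \<mapsto> i + j - d\<close>, and for these \<open>p\<close> one of the two colors occurs
  on at most two residues. The proof runs through all colorings of the residues.\<close>

lemma symmetric_coloring:
  fixes F :: "int \<Rightarrow> nat"
  assumes "p = 3 \<or> p = 5" and F: "\<And>d. F d < 2" and periodic: "\<And>d e. p dvd d - e \<Longrightarrow> F d = F e"
  shows "\<exists>a. \<forall>d. F (a - d) = F d"
proof -
  have *: "\<forall>d. F (a - d) = F d" if "\<And>d. d \<in> {0..<p} \<Longrightarrow> F ((a - d) mod p) = F d" for a
  proof
    fix d
    have "d mod p \<in> {0..<p}" using assms(1) by auto
    moreover have "F (a - d) = F ((a - d mod p) mod p)" "F d = F (d mod p)"
      by (rule periodic, simp add: mod_eq_dvd_iff[symmetric] mod_simps)+
    ultimately show "F (a - d) = F d" using that by metis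
  qed
  have F01: "F d = 0 \<or> F d = 1" for d using F[of d] by auto
  from assms(1) show ?thesis
  proof
    assume p: "p = 3"
    have range: "{0..<p} = {0, 1, 2}" by (auto simp: p)
    have "\<exists>a\<in>{0, 1, 2}. \<forall>d\<in>{0, 1, 2}. F ((a - d) mod p) = F d"
      using F01[of 0] F01[of 1] F01[of 2] by (elim disjE) (simp_all add: p)
    then show ?thesis using * unfolding range by blast
  next
    assume p: "p = 5"
    have range: "{0..<p} = {0, 1, 2, 3, 4}" by (auto simp: p)
    have "\<exists>a\<in>{0, 1, 2, 3, 4}. \<forall>d\<in>{0, 1, 2, 3, 4}. F ((a - d) mod p) = F d"
      using F01[of 0] F01[of 1] F01[of 2] F01[of 3] F01[of 4] by (elim disjE) (simp_all add: p)
    then show ?thesis using * unfolding range by blast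
  qed
qed

context coordinates
begin

text \<open>A rotation by \<open>t\<close> agreeing with the reflection at positions 0 and 1 would
  make \<open>s - t\<close> congruent to both 0 and 2 modulo \<open>m 0\<close>.\<close>

lemma reflection_not_rotation:
  assumes f: "f \<in> rotations" and refl: "\<And>v. v \<in> V \<Longrightarrow> c v = 0 \<Longrightarrow> m 0 dvd x (f v) - (s - x v)"
  shows False
proof -
  obtain t where t: "\<And>v. v \<in> V \<Longrightarrow> c (f v) = c v \<and> m (c v) dvd x (f v) - (x v + t)"
    using f by (auto simp: rotations_def)
  have *: "m 0 dvd s - t - 2 * a" for a
  proof -
    define v where "v = vertex 0 a"
    have v: "v \<in> V" "c v = 0" "m 0 dvd x v - a" using vertex[OF r_pos] by (simp_all add: v_def)
    have "m 0 dvd x (f v) - (x v + t)" using t[OF v(1)] v(2) by simp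
    from dvd_add[OF dvd_diff[OF this refl[OF v(1,2)]] dvd_mult[OF v(3), of 2]]
    show ?thesis by (simp add: algebra_simps)
  qed
  from dvd_diff[OF *[of 0] *[of 1]] have "m 0 dvd 2" by simp
  then show False using not_dvd_small[OF r_pos] m_0_ge by auto
qed

lemma ex_rotation:
  obtains f where "f \<in> rotations" "\<And>v. v \<in> V \<Longrightarrow> c (f v) = c v"
    "\<And>v. v \<in> V \<Longrightarrow> m (c v) dvd x (f v) - (x v + t)"
proof (rule ex_affine[of 1 "\<lambda>_. t"])
  fix f assume f: "f permutes V" "\<And>v. v \<in> V \<Longrightarrow> c (f v) = c v"
    "\<And>v. v \<in> V \<Longrightarrow> m (c v) dvd x (f v) - (t + 1 * x v)"
  then have "f \<in> rotations" by (auto simp: rotations_def add.commute)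
  then show thesis using that f by (simp add: add.commute)
qed simp

text \<open>
  On each pair of vertices of one orbit the reflection agrees with a rotation, so that only pairs
  of vertices from different orbits can distinguish the two.
\<close>

lemma rotations_neq_Aut:
  assumes "V \<subseteq> V0"
    and cross: "\<And>f u v. f permutes V \<Longrightarrow> (\<And>v. v \<in> V \<Longrightarrow> c (f v) = c v) \<Longrightarrow>
          (\<And>v. v \<in> V \<Longrightarrow> m (c v) dvd x (f v) - (s (c v) - x v)) \<Longrightarrow>
          u \<in> V \<Longrightarrow> v \<in> V \<Longrightarrow> c u < c v \<Longrightarrow> E {f u, f v} = E {u, v}"
  shows "rotations \<noteq> Aut V0 E"
proof
  assume Aut: "rotations = Aut V0 E"
  obtain f where f: "f permutes V" "\<And>v. v \<in> V \<Longrightarrow> c (f v) = c v"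
      "\<And>v. v \<in> V \<Longrightarrow> m (c v) dvd x (f v) - (s (c v) - x v)"
    by (rule ex_affine[of "-1" s]) auto
  have fV: "f v \<in> V" if "v \<in> V" for v using permutes_in_image[OF f(1)] that by simp
  have rot: "E {g u, g v} = E {u, v}" if "g \<in> rotations" "u \<in> V0" "v \<in> V0" "u \<noteq> v" for g u v
    using that unfolding Aut by (simp add: Aut_iff)
  \<comment> \<open>The rotation \<open>g\<close> sends \<open>u\<close> to the position of
    \<open>f v\<close> and \<open>v\<close> to that of \<open>f u\<close>, so \<open>f\<close> and
    \<open>g\<close> give the same unordered pair.\<close>
  have inner: "E {f u, f v} = E {u, v}" if uv: "u \<in> V" "v \<in> V" "c u = c v" "u \<noteq> v" for u v
  proof -
    obtain g where g: "g \<in> rotations" "\<And>w. w \<in> V \<Longrightarrow> c (g w) = c w"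
        "\<And>w. w \<in> V \<Longrightarrow> m (c w) dvd x (g w) - (x w + (s (c u) - x u - x v))"
      by (rule ex_rotation[of "s (c u) - x u - x v"]) (rule that)
    have gV: "g w \<in> V" if "w \<in> V" for w
      using permutes_in_image[OF rotation_permutes[OF g(1)]] that by simp
    have "g u = vertex (c v) (s (c v) - x v)"
      using g(2)[OF uv(1)] g(3)[OF uv(1)] uv(3) by (intro vertex_unique gV uv) (simp_all add: algebra_simps)
    moreover have "f v = vertex (c v) (s (c v) - x v)"
      using f(2)[OF uv(2)] f(3)[OF uv(2)] by (intro vertex_unique fV uv)
    moreover have "g v = vertex (c u) (s (c u) - x u)"
      using g(2)[OF uv(2)] g(3)[OF uv(2)] uv(3) by (intro vertex_unique gV uv) (simp_all add: algebra_simps)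
    moreover have "f u = vertex (c u) (s (c u) - x u)"
      using f(2)[OF uv(1)] f(3)[OF uv(1)] by (intro vertex_unique fV uv)
    ultimately have "{f u, f v} = {g u, g v}" by auto
    then show ?thesis using rot[OF g(1)] uv assms(1) by auto
  qed
  \<comment> \<open>All rotations fix \<open>w\<close>, in particular the one that takes
    \<open>u\<close> to \<open>f u\<close>.\<close>
  have outer: "E {f u, w} = E {u, w}" if u: "u \<in> V" and w: "w \<in> V0" "w \<notin> V" for u w
  proof -
    obtain g where g: "g \<in> rotations" "\<And>w. w \<in> V \<Longrightarrow> c (g w) = c w"
        "\<And>w. w \<in> V \<Longrightarrow> m (c w) dvd x (g w) - (x w + (s (c u) - 2 * x u))"
      by (rule ex_rotation[of "s (c u) - 2 * x u"]) (rule that)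
    have gV: "g u \<in> V"
      using permutes_in_image[OF rotation_permutes[OF g(1)]] u by simp
    have "g u = vertex (c u) (s (c u) - x u)"
      using g(2)[OF u] g(3)[OF u] by (intro vertex_unique gV u) (simp_all add: algebra_simps)
    moreover have "f u = vertex (c u) (s (c u) - x u)"
      using f(2)[OF u] f(3)[OF u] by (intro vertex_unique fV u)
    moreover have "g w = w" using permutes_not_in[OF rotation_permutes[OF g(1)] w(2)] .
    ultimately have "{f u, w} = {g u, g w}" by simp
    then show ?thesis using rot[OF g(1), of u w] u w assms(1) by auto
  qed
  have "E {f u, f v} = E {u, v}" if uv: "u \<in> V0" "v \<in> V0" "u \<noteq> v" for u v
  proof -
    have fix_outside: "f w = w" if "w \<notin> V" for w using permutes_not_in[OF f(1) that] .
    consider "u \<in> V" "v \<in> V" "c u = c v" | "u \<in> V" "v \<in> V" "c u < c v" | "u \<in> V" "v \<in> V" "c v < c u"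
      | "u \<in> V" "v \<notin> V" | "u \<notin> V" "v \<in> V" | "u \<notin> V" "v \<notin> V"
      by (metis linorder_neqE_nat)
    then show ?thesis
    proof cases
      case 1 then show ?thesis using inner uv by simp
    next
      case 2 then show ?thesis using cross[OF f] by simp
    next
      case 3 then show ?thesis using cross[OF f, of v u] by (simp add: insert_commute)
    next
      case 4 then show ?thesis using outer[of u v] uv fix_outside by simp
    next
      case 5 then show ?thesis using outer[of v u] uv fix_outside by (simp add: insert_commute)
    next
      case 6 then show ?thesis using fix_outside by simp
    qed
  qed
  then have "f \<in> rotations"
    using permutes_subset[OF f(1) assms(1)] unfolding Aut by (simp add: Aut_iff)
  then show False
    by (rule reflection_not_rotation[of f "s 0"]) (use f(3) in metis)
qed

text \<open>No two vertices lie in different nontrivial orbits, so every coloring invariant under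
  the rotations is also invariant under a reflection.\<close>

lemma one_orbit_not_GR:
  assumes "r = 1" and "V \<subseteq> V0"
  shows "(rotations, V0) \<notin> GR_any"
proof
  assume "(rotations, V0) \<in> GR_any"
  then obtain E where "rotations = Aut V0 E" by (auto simp: GR_any_def mem_GR_iff)
  moreover have "rotations \<noteq> Aut V0 E"
  proof (rule rotations_neq_Aut[OF assms(2)])
    fix f u v assume "u \<in> V" "v \<in> V" "c u < c v"
    then show "E {f u, f v} = E {u, v}" using class_less[of v] assms(1) by simp
  qed
  ultimately show False by blast
qed

text \<open>Invariance under rotations makes the color of an edge between the orbits a function
  \<open>F\<close> of the difference modulo \<open>m 1\<close>. If \<open>F (a - d) = F d\<close>
  for all \<open>d\<close>, then reflecting orbit 0 by \<open>x \<mapsto> - x\<close> and orbit 1 by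
  \<open>x \<mapsto> a - x\<close> preserves these colors.\<close>

lemma two_orbits_not_GR_2:
  assumes r: "r = 2" and m1: "m 1 = 3 \<or> m 1 = 5" and "V \<subseteq> V0"
  shows "(rotations, V0) \<notin> GR 2"
proof
  assume "(rotations, V0) \<in> GR 2"
  then obtain E where E: "colored_graph 2 V0 E" and Aut: "rotations = Aut V0 E"
    by (auto simp: mem_GR_iff)
  have r1: "1 < r" using r by simp
  have m10: "m 1 dvd m 0" using m_dvd[of 0 1] r by simp
  define F where "F d = E {vertex 0 0, vertex 1 d}" for d
  have EF: "E {u, v} = F (x v - x u)" if uv: "u \<in> V" "v \<in> V" "c u = 0" "c v = 1" for u v
  proof -
    obtain g where g: "g \<in> rotations" "\<And>w. w \<in> V \<Longrightarrow> c (g w) = c w"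
        "\<And>w. w \<in> V \<Longrightarrow> m (c w) dvd x (g w) - (x w + (- x u))"
      by (rule ex_rotation[of "- x u"]) (rule that)
    have gV: "g w \<in> V" if "w \<in> V" for w
      using permutes_in_image[OF rotation_permutes[OF g(1)]] that by simp
    have "g u = vertex 0 0"
      using g(2)[OF uv(1)] g(3)[OF uv(1)] uv by (intro vertex_unique gV) simp_all
    moreover have "g v = vertex 1 (x v - x u)"
      using g(2)[OF uv(2)] g(3)[OF uv(2)] uv by (intro vertex_unique gV) simp_all
    moreover have "E {g u, g v} = E {u, v}"
    proof -
      have "u \<noteq> v" using uv by auto
      then show ?thesis using g(1) uv assms(3) unfolding Aut by (auto simp: Aut_iff)
    qed
    ultimately show ?thesis by (simp add: F_def)
  qed
  have periodic: "F d = F e" if "m 1 dvd d - e" for d e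
  proof -
    have "vertex 1 d = vertex 1 e" using that vertex_eq_iff[OF r1] by simp
    then show ?thesis by (simp add: F_def)
  qed
  have "\<exists>a. \<forall>d. F (a - d) = F d"
  proof (rule symmetric_coloring[OF m1 _ periodic])
    show "F d < 2" for d
    proof -
      have "vertex 0 0 \<noteq> vertex 1 d" using vertex(2)[OF r_pos, of 0] vertex(2)[OF r1, of d] by auto
      then have "{vertex 0 0, vertex 1 d} \<in> [V0]\<^bsup>2\<^esup>"
        using vertex(1)[OF r_pos, of 0] vertex(1)[OF r1, of d] assms(3) by auto
      then show ?thesis using E unfolding F_def colored_graph_def by blast
    qed
  qed
  then obtain a where a: "\<And>d. F (a - d) = F d" by blast
  have "rotations \<noteq> Aut V0 E"
  proof (rule rotations_neq_Aut[OF assms(3), of "\<lambda>j. if j = 0 then 0 else a"])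
    fix f u v
    assume f: "f permutes V" "\<And>v. v \<in> V \<Longrightarrow> c (f v) = c v"
      "\<And>v. v \<in> V \<Longrightarrow> m (c v) dvd x (f v) - ((if c v = 0 then 0 else a) - x v)"
      and uv: "u \<in> V" "v \<in> V" "c u < c v"
    have c: "c u = 0" "c v = 1" using class_less[OF uv(2)] uv(3) r by auto
    have fV: "f u \<in> V" "f v \<in> V" using permutes_in_image[OF f(1)] uv by simp_all
    have "m 1 dvd x (f v) - (a - x v)" using f(3)[OF uv(2)] c by simp
    moreover have "m 1 dvd x (f u) - (0 - x u)" using f(3)[OF uv(1)] c dvd_trans[OF m10] by simp
    ultimately have "m 1 dvd (x (f v) - (a - x v)) - (x (f u) - (0 - x u))" by (rule dvd_diff)
    then have "F (x (f v) - x (f u)) = F (a - (x v - x u))"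
      by (intro periodic) (simp add: algebra_simps)
    then show "E {f u, f v} = E {u, v}"
      using EF[OF fV] EF[OF uv(1,2)] c f(2) uv a by simp
  qed
  then show False using Aut by blast
qed

end

section \<open>Coordinates of cyclic groups\<close>

lemma sym_group_on_pow: "g [^]\<^bsub>sym_group_on V\<^esub> (k::nat) = g ^^ k"
  by (induction k) (simp_all add: sym_group_on_def nat_pow_Suc nat_pow_0 funpow_Suc_right del: funpow.simps(2))

text \<open>Positive cardinality makes \<open>A\<close> finite, so the natural powers of a generator
  exhaust it and its order is \<open>card A\<close>.\<close>

lemma cyclic_permutation_groupE:
  assumes "cyclic_permutation_group A V" and "card A > 0"
  obtains g where "g permutes V" "A = range (\<lambda>k. g ^^ k)" "\<And>k. g ^^ k = id \<longleftrightarrow> card A dvd k"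
proof -
  interpret group "sym_group_on V" by (rule group_sym_group_on)
  obtain g where g: "g \<in> carrier (sym_group_on V)" "A = generate (sym_group_on V) {g}"
    using assms(1) by (auto simp: cyclic_permutation_group_def)
  have ord: "ord g = card A" using generate_pow_card[OF g(1)] g(2) by simp
  show thesis
  proof
    show "g permutes V" using g(1) by (simp add: sym_group_on_def)
    show "A = range (\<lambda>k. g ^^ k)"
      using generate_pow_nat[OF g(1)] g(2) ord assms(2) by (auto simp: sym_group_on_pow)
    show "g ^^ k = id \<longleftrightarrow> card A dvd k" for k
      using pow_eq_id[OF g(1), of k] by (simp add: ord sym_group_on_pow) (simp add: sym_group_on_def)
  qed
qed

text \<open>\<open>least_power g v\<close> is the length of the orbit of \<open>v\<close>. Integer
  differences make the criterion symmetric in \<open>i\<close> and \<open>j\<close>, which is the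
  form that coordinates need.\<close>

lemma funpow_eq_iff_least_power:
  assumes "permutation g"
  shows "(g ^^ i) v = (g ^^ j) v \<longleftrightarrow> int (least_power g v) dvd int i - int j"
proof -
  have inj: "inj (g ^^ i)" for i
    using assms by (simp add: bij_is_inj permutation_bijective bij_fn)
  have *: "(g ^^ i) v = (g ^^ j) v \<longleftrightarrow> int (least_power g v) dvd int i - int j" if "i \<le> j" for i j
  proof -
    have "(g ^^ j) v = (g ^^ i) ((g ^^ (j - i)) v)"
      using that by (metis comp_apply funpow_add le_add_diff_inverse)
    then have "(g ^^ i) v = (g ^^ j) v \<longleftrightarrow> (g ^^ (j - i)) v = v"
      using inj by (metis inj_eq)
    also have "\<dots> \<longleftrightarrow> least_power g v dvd j - i" using least_power_dvd[OF assms] by simp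
    also have "\<dots> \<longleftrightarrow> int (least_power g v) dvd int j - int i"
      unfolding of_nat_diff[OF that, symmetric] by simp
    finally show ?thesis by (simp only: dvd_diff_commute[of _ "int j" "int i"])
  qed
  show ?thesis
  proof (cases "i \<le> j")
    case False
    then have "(g ^^ j) v = (g ^^ i) v \<longleftrightarrow> int (least_power g v) dvd int j - int i"
      by (intro *) simp
    then show ?thesis by (simp only: dvd_diff_commute[of _ "int j" "int i"] eq_commute)
  qed (rule *)
qed

lemma card_orbit_eq_least_power:
  assumes "permutation g"
  shows "card (range (\<lambda>k. (g ^^ k) v)) = least_power g v"
proof -
  have pos: "least_power g v > 0" by (rule least_power_of_permutation(2)[OF assms])
  have "range (\<lambda>k. (g ^^ k) v) = (\<lambda>k. (g ^^ k) v) ` {..<least_power g v}"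
  proof -
    have "(g ^^ k) v = (g ^^ (k mod least_power g v)) v" for k
      unfolding funpow_eq_iff_least_power[OF assms] by (simp add: zmod_int minus_mod_eq_mult_div)
    then show ?thesis using pos by (force intro: mod_less_divisor)
  qed
  moreover have "inj_on (\<lambda>k. (g ^^ k) v) {..<least_power g v}"
  proof (rule inj_onI)
    fix i j assume "i \<in> {..<least_power g v}" "j \<in> {..<least_power g v}" "(g ^^ i) v = (g ^^ j) v"
    then show "i = j"
      by (simp add: funpow_eq_iff_least_power[OF assms] mod_eq_dvd_iff[symmetric])
  qed
  ultimately show ?thesis by (simp add: card_image)
qed

lemma orbit_funpow_eq:
  assumes "permutation g"
  shows "range (\<lambda>k. (g ^^ k) ((g ^^ i) v)) = range (\<lambda>k. (g ^^ k) v)"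
proof (intro equalityI subsetI)
  fix w assume "w \<in> range (\<lambda>k. (g ^^ k) ((g ^^ i) v))"
  then obtain k where "w = (g ^^ (k + i)) v" by (auto simp: funpow_add)
  then show "w \<in> range (\<lambda>k. (g ^^ k) v)" by blast
next
  fix w assume "w \<in> range (\<lambda>k. (g ^^ k) v)"
  then obtain k where k: "w = (g ^^ k) v" by blast
  let ?d = "least_power g v"
  have "?d > 0" by (rule least_power_of_permutation(2)[OF assms])
  \<comment> \<open>Natural exponents cannot always be lowered by \<open>i\<close>, so
    \<open>i\<close> is subtracted from the multiple \<open>?d * i\<close> of the period
    instead.\<close>
  then have "k + (?d * i - i) + i = k + ?d * i" by (cases ?d) simp_all
  moreover have "(g ^^ (k + ?d * i)) v = (g ^^ k) v"
    by (simp add: funpow_eq_iff_least_power[OF assms])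
  ultimately have "(g ^^ (k + (?d * i - i) + i)) v = (g ^^ k) v"
    by (simp only:)
  then have "w = (g ^^ (k + (?d * i - i))) ((g ^^ i) v)" using k by (simp only: funpow_add o_apply)
  then show "w \<in> range (\<lambda>k. (g ^^ k) ((g ^^ i) v))" by blast
qed

text \<open>The nontrivial orbits of a generator \<open>g\<close> are numbered by decreasing size;
  orbit \<open>j\<close> gets a base point \<open>b j\<close>, and \<open>x v\<close> is an exponent
  taking the base point to \<open>v\<close>. The orbit lengths divide \<open>p ^ n\<close>, hence
  are powers of \<open>p\<close>, each dividing the earlier ones.\<close>

lemma cyclic_coordinates:
  fixes p n :: nat
  assumes p: "prime p" "p \<noteq> 2" and n: "n \<ge> 2" and V: "finite V"
    and A: "cyclic_permutation_group A V" "card A = p ^ n"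
  obtains U r m c x where "coordinates U r m c x" "U \<subseteq> V" "A = coordinates.rotations U m c x"
    "m 0 = int (p ^ n)" "\<And>j. j < r \<Longrightarrow> \<exists>i\<in>{1..n}. m j = int (p ^ i)"
    "\<And>i. i \<in> {1..n} \<Longrightarrow> card {X \<in> perm_orbits A V. card X = p ^ i} = card {j. j < r \<and> m j = int (p ^ i)}"
proof -
  have p_odd: "odd p" using p prime_odd_nat[of p] prime_ge_2_nat[of p] by force
  have p3: "3 \<le> p" using p_odd prime_ge_2_nat[OF p(1)] p(2) by linarith
  have "card A > 0" using A(2) p3 by simp
  then obtain g where g: "g permutes V" "A = range (\<lambda>k. g ^^ k)" "\<And>k. g ^^ k = id \<longleftrightarrow> p ^ n dvd k"
    using cyclic_permutation_groupE[OF A(1)] A(2) by metis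
  have perm: "permutation g" using g(1) V permutation_permutes by blast
  have gk: "(g ^^ k) permutes V" for k by (rule permutes_funpow[OF g(1)])
  define d where "d v = least_power g v" for v
  define Or where "Or v = range (\<lambda>k. (g ^^ k) v)" for v
  note eq_iff = funpow_eq_iff_least_power[OF perm, folded d_def]
  have card_Or: "card (Or v) = d v" for v
    unfolding Or_def d_def by (rule card_orbit_eq_least_power[OF perm])
  have Or_pow: "Or ((g ^^ i) v) = Or v" for i v
    unfolding Or_def by (rule orbit_funpow_eq[OF perm])
  have Or_self: "v \<in> Or v" for v
    unfolding Or_def by (rule range_eqI[of _ _ 0]) simp
  have d_iff: "(g ^^ k) v = v \<longleftrightarrow> d v dvd k" for k v
    using least_power_dvd[OF perm] by (simp add: d_def)
  have d_dvd: "d v dvd p ^ n" for v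
  proof -
    have "g ^^ (p ^ n) = id" using g(3) by simp
    then show ?thesis using d_iff[of "p ^ n" v] by simp
  qed
  have d_outside: "d v = 1" if "v \<notin> V" for v
    using d_iff[of 1 v] permutes_not_in[OF g(1) that] by simp
  have orbits: "perm_orbits A V = Or ` V"
    unfolding perm_orbits_altdef Or_def g(2) by (simp add: image_image)
  define M where "M = {X \<in> perm_orbits A V. 1 < card X}"
  have "finite M" using V by (simp add: M_def orbits)
  then obtain ys where ys: "set ys = M" "distinct ys" using finite_distinct_list by blast
  \<comment> \<open>Negated sizes sort the orbits in decreasing order.\<close>
  define xs where "xs = sort_key (\<lambda>X. - int (card X)) ys"
  have xs: "set xs = M" "distinct xs" "sorted (map (\<lambda>X. - int (card X)) xs)"
    using ys by (simp_all add: xs_def)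
  define r where "r = length xs"
  define m where "m j = int (card (xs ! j))" for j
  \<comment> \<open>Fixed points of the group are left out.\<close>
  define U where "U = {v \<in> V. 1 < d v}"
  have U_iff: "v \<in> U \<longleftrightarrow> v \<in> V \<and> Or v \<in> set xs" for v
    by (auto simp: U_def xs(1) M_def orbits card_Or)
  define c where "c v = (SOME j. j < r \<and> xs ! j = Or v)" for v
  have c: "c v < r" "xs ! (c v) = Or v" if "v \<in> U" for v
  proof -
    have "\<exists>j. j < r \<and> xs ! j = Or v"
      using that by (simp add: U_iff r_def in_set_conv_nth)
    from someI_ex[OF this] show "c v < r" "xs ! (c v) = Or v" by (simp_all add: c_def)
  qed
  define b where "b j = (SOME v. v \<in> V \<and> Or v = xs ! j)" for j
  have b: "b j \<in> V" "Or (b j) = xs ! j" if "j < r" for j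
  proof -
    have "xs ! j \<in> M" using that xs(1) by (auto simp: r_def)
    then have "\<exists>v. v \<in> V \<and> Or v = xs ! j" by (auto simp: M_def orbits)
    from someI_ex[OF this] show "b j \<in> V" "Or (b j) = xs ! j" by (simp_all add: b_def)
  qed
  have m_b: "m j = int (d (b j))" if "j < r" for j
    using card_Or[of "b j"] b[OF that] by (simp add: m_def)
  define x where "x v = int (SOME t. (g ^^ t) (b (c v)) = v)" for v
  have x: "(g ^^ nat (x v)) (b (c v)) = v" "0 \<le> x v" if v: "v \<in> U" for v
  proof -
    have "v \<in> Or (b (c v))" using Or_self[of v] b(2)[OF c(1)[OF v]] c(2)[OF v] by simp
    then have "\<exists>t. (g ^^ t) (b (c v)) = v" unfolding Or_def by (metis rangeE)
    from someI_ex[OF this] show "(g ^^ nat (x v)) (b (c v)) = v" by (simp add: x_def)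
    show "0 \<le> x v" by (simp add: x_def)
  qed
  have m_prime_power: "\<exists>i\<in>{1..n}. m j = int (p ^ i)" if j: "j < r" for j
  proof -
    obtain i where i: "i \<le> n" "d (b j) = p ^ i"
      using d_dvd[of "b j"] divides_primepow_nat[OF p(1)] by blast
    have "xs ! j \<in> M" using j xs(1) by (auto simp: r_def)
    then have "1 < d (b j)" using card_Or[of "b j"] b(2)[OF j] by (simp add: M_def)
    then have "i \<noteq> 0" using i(2) by (cases i) auto
    then show ?thesis using i m_b[OF j] by auto
  qed
  have c_eqI: "c v = j" if "v \<in> U" "j < r" "Or v = xs ! j" for v j
    using c[OF that(1)] that(2,3) xs(2) by (simp add: r_def nth_eq_iff_index_eq)
  have m_anti: "m k \<le> m j" if "j \<le> k" "k < r" for j k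
    using sorted_nth_mono[OF xs(3), of j k] that by (simp add: m_def r_def)
  have Uk: "(g ^^ k) v \<in> U \<longleftrightarrow> v \<in> U" for k v
    using permutes_in_image[OF gk, of k v] by (simp add: U_iff Or_pow)
  have c_pow: "c ((g ^^ k) v) = c v" for k v by (simp add: c_def Or_pow)
  obtain v0 where v0: "v0 \<in> V" "d v0 = p ^ n"
  proof -
    \<comment> \<open>An orbit of full length \<open>p ^ n\<close> must exist: otherwise all orbit
      lengths would divide \<open>p ^ (n - 1)\<close> and \<open>g ^^ (p ^ (n - 1))\<close> would be
      the identity.\<close>
    have "\<exists>v\<in>V. \<not> d v dvd p ^ (n - 1)"
    proof (rule ccontr)
      assume "\<not> ?thesis"
      then have "d v dvd p ^ (n - 1)" for v using d_outside[of v] by (cases "v \<in> V") auto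
      then have "g ^^ (p ^ (n - 1)) = id" using d_iff by auto
      then have "p ^ n dvd p ^ (n - 1)" using g(3) by simp
      then have "p ^ n \<le> p ^ (n - 1)" using p3 by (intro dvd_imp_le) auto
      moreover have "p ^ (n - 1) < p ^ n" using p3 n by (intro power_strict_increasing) auto
      ultimately show False by simp
    qed
    then obtain v where v: "v \<in> V" "\<not> d v dvd p ^ (n - 1)" by blast
    obtain i where i: "i \<le> n" "d v = p ^ i"
      using d_dvd[of v] divides_primepow_nat[OF p(1)] by blast
    have "\<not> i \<le> n - 1" using v(2) i(2) le_imp_power_dvd by metis
    then have "i = n" using i(1) by simp
    then show thesis using that v(1) i(2) by simp
  qed
  have "v0 \<in> U" using v0 p3 n one_less_power[of p n] by (simp add: U_def)
  have r_pos: "0 < r" using c(1)[OF \<open>v0 \<in> U\<close>] by simp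
  have m0: "m 0 = int (p ^ n)"
  proof -
    have "m (c v0) = int (p ^ n)" using c(2)[OF \<open>v0 \<in> U\<close>] card_Or[of v0] v0(2) by (simp add: m_def)
    then have "int (p ^ n) \<le> m 0" using m_anti[of 0 "c v0"] c(1)[OF \<open>v0 \<in> U\<close>] by simp
    moreover have "m 0 \<le> int (p ^ n)"
      using m_b[OF r_pos] dvd_imp_le[OF d_dvd[of "b 0"]] p3 by simp
    ultimately show ?thesis by simp
  qed
  have coords: "coordinates U r m c x"
  proof
    show "finite U" using V by (simp add: U_def)
    show "0 < r" by (rule r_pos)
    show "c v < r" if "v \<in> U" for v by (rule c(1)[OF that])
    show "u = v" if "u \<in> U" "v \<in> U" "c u = c v" "m (c v) dvd x u - x v" for u v
    proof -
      have "(g ^^ nat (x u)) (b (c v)) = (g ^^ nat (x v)) (b (c v))"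
        using that x(2) m_b[OF c(1)[OF that(2)]] by (simp add: eq_iff)
      then show ?thesis using x(1) that by metis
    qed
    show "\<exists>v\<in>U. c v = j \<and> m j dvd x v - a" if j: "j < r" for j a
    proof -
      define v where "v = (g ^^ nat (a mod m j)) (b j)"
      have "m j > 0" using m_prime_power[OF j] p3 by auto
      have "b j \<in> U" using b[OF j] j by (simp add: U_iff r_def)
      then have v: "v \<in> U" by (simp add: v_def Uk)
      have cv: "c v = j" using c_eqI[OF \<open>b j \<in> U\<close> j b(2)[OF j]] by (simp add: v_def c_pow)
      have "(g ^^ nat (x v)) (b j) = (g ^^ nat (a mod m j)) (b j)"
        using x(1)[OF v] cv by (simp add: v_def)
      then have "m j dvd x v - a mod m j"
        using x(2)[OF v] \<open>m j > 0\<close> by (simp add: eq_iff m_b[OF j])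
      then have "m j dvd x v - a" by (simp add: mod_eq_dvd_iff[symmetric])
      then show ?thesis using v cv by blast
    qed
    show "odd (m j)" if "j < r" for j using m_prime_power[OF that] p_odd by auto
    show "3 \<le> m j" if j: "j < r" for j
    proof -
      obtain i where i: "i \<in> {1..n}" "m j = int (p ^ i)" using m_prime_power[OF j] by blast
      have "p \<le> p ^ i" using i(1) p3 by (intro self_le_power) auto
      then show ?thesis using i(2) p3 by linarith
    qed
    show "m k dvd m j" if jk: "j \<le> k" "k < r" for j k
    proof -
      obtain i where i: "m k = int (p ^ i)" using m_prime_power[OF jk(2)] by blast
      obtain i' where i': "m j = int (p ^ i')" using m_prime_power[of j] jk by auto
      \<comment> \<open>For powers of \<open>p\<close>, the order by size is the order by
        divisibility.\<close>
      have "int p ^ i \<le> int p ^ i'" using m_anti[OF jk] i i' by simp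
      then have "i \<le> i'" using p3 power_le_imp_le_exp[of "int p" i i'] by simp
      then show ?thesis using i i' by (simp add: le_imp_power_dvd)
    qed
    have "3 ^ 2 \<le> p ^ 2" using p3 by (intro power_mono) auto
    also have "\<dots> \<le> p ^ n" using p3 n by (intro power_increasing) auto
    finally have "9 \<le> p ^ n" by simp
    from of_nat_mono[OF this, where 'a = int] show "9 \<le> m 0" using m0 by simp
  qed
  interpret coordinates U r m c x by (rule coords)
  have "A = rotations"
  proof (intro equalityI subsetI)
    fix f assume "f \<in> A"
    then obtain k where f: "f = g ^^ k" using g(2) by blast
    have "f v = v" if "v \<in> V - U" for v
    proof -
      have "d v \<le> 1" using that by (auto simp: U_def)
      then have "d v dvd k" using d_dvd[of v] p3 by (cases "d v") auto
      then show ?thesis using d_iff f by simp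
    qed
    then have "f permutes U" using gk[of k] f by (intro permutes_superset[of f V U]) auto
    moreover have "c (f v) = c v \<and> m (c v) dvd x (f v) - (x v + int k)" if v: "v \<in> U" for v
    proof -
      have fv: "f v \<in> U" "c (f v) = c v" using v by (simp_all add: f Uk c_pow)
      have "(g ^^ nat (x (f v))) (b (c v)) = (g ^^ k) v" using x(1)[OF fv(1)] fv(2) f by simp
      also have "\<dots> = (g ^^ (k + nat (x v))) (b (c v))"
        using x(1)[OF v] by (simp add: funpow_add)
      finally show ?thesis
        using x(2)[OF v] x(2)[OF fv(1)] fv(2) by (simp add: eq_iff m_b[OF c(1)[OF v]] algebra_simps)
    qed
    ultimately show "f \<in> rotations" unfolding rotations_def by blast
  next
    fix f assume "f \<in> rotations"
    then obtain t where f: "f permutes U"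
        and t: "\<And>v. v \<in> U \<Longrightarrow> c (f v) = c v \<and> m (c v) dvd x (f v) - (x v + t)"
      unfolding rotations_def by blast
    \<comment> \<open>The shift \<open>t\<close> may be any integer; its residue modulo
      \<open>m 0\<close> is a natural exponent giving the same rotation, since all orbit lengths
      divide \<open>m 0\<close>.\<close>
    define k where "k = nat (t mod m 0)"
    have k: "m 0 dvd t - int k" using m_0_ge by (simp add: k_def minus_mod_eq_mult_div)
    have "f v = (g ^^ k) v" for v
    proof (cases "v \<in> U")
      case True
      have fv: "f v \<in> U" "c (f v) = c v" using permutes_in_image[OF f] True t by auto
      have "m (c v) dvd t - int k" using k m_dvd[of 0 "c v"] c(1)[OF True] dvd_trans by blast
      from dvd_add[OF _ this, of "x (f v) - (x v + t)"] have "m (c v) dvd x (f v) - (int k + x v)"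
        using t[OF True] by (simp add: algebra_simps)
      then have "(g ^^ nat (x (f v))) (b (c v)) = (g ^^ (k + nat (x v))) (b (c v))"
        using x(2)[OF fv(1)] x(2)[OF True] by (simp add: eq_iff m_b[OF c(1)[OF True]])
      also have "\<dots> = (g ^^ k) v" using x(1)[OF True] by (simp add: funpow_add)
      finally show ?thesis using x(1)[OF fv(1)] fv(2) by simp
    next
      case False
      have "d v \<le> 1" using False d_outside[of v] by (cases "v \<in> V") (auto simp: U_def)
      then have "d v dvd k" using d_dvd[of v] p3 by (cases "d v") auto
      then have "(g ^^ k) v = v" using d_iff by blast
      then show ?thesis using permutes_not_in[OF f False] by simp
    qed
    then have "f = g ^^ k" by (rule ext)
    then show "f \<in> A" unfolding g(2) by blast
  qed
  moreover have "card {X \<in> perm_orbits A V. card X = p ^ i} = card {j. j < r \<and> m j = int (p ^ i)}"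
    if i: "i \<in> {1..n}" for i
  proof -
    \<comment> \<open>As \<open>i\<close> is positive, the orbits counted are nontrivial and hence
      all occur in \<open>xs\<close>.\<close>
    have "1 < p ^ i" using i p3 by (intro one_less_power) auto
    then have "{X \<in> perm_orbits A V. card X = p ^ i} = {X \<in> set xs. card X = p ^ i}"
      by (auto simp: xs(1) M_def)
    also have "\<dots> = (\<lambda>j. xs ! j) ` {j. j < r \<and> m j = int (p ^ i)}"
      by (auto simp: in_set_conv_nth r_def m_def)
    also have "card \<dots> = card {j. j < r \<and> m j = int (p ^ i)}"
      using xs(2) by (intro card_image inj_onI) (auto simp: r_def nth_eq_iff_index_eq)
    finally show ?thesis .
  qed
  ultimately show thesis
    using that[OF coords] m0 m_prime_power by (auto simp: U_def)
qed

section \<open>Case distinction by the number of nontrivial orbits\<close>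

theorem theorem4p5:
  fixes p n :: nat and A :: "('a \<Rightarrow> 'a) set" and V :: "'a set" and k :: "nat \<Rightarrow> nat"
  assumes "prime p" and "p \<noteq> 2" and "n \<ge> 2"
    and "finite V"
    and "cyclic_permutation_group A V" and "card A = p ^ n"
    and "\<And>i. i \<in> {1..n} \<Longrightarrow> k i = card {X \<in> perm_orbits A V. card X = p ^ i}"
  shows "((\<Sum>i=1..n. k i) = 1 \<longrightarrow> (A, V) \<notin> GR_any) \<and>
         ((\<Sum>i=1..n. k i) = 2 \<longrightarrow>
            (if k 1 \<in> {1, 2} \<and> p \<in> {3, 5} then (A, V) \<in> GR_star 3 else (A, V) \<in> GR 2)) \<and>
         ((\<Sum>i=1..n. k i) > 2 \<longrightarrow> (A, V) \<in> GR 2)"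
proof -
  obtain U r m c x where co: "coordinates U r m c x" and U: "U \<subseteq> V"
    and A: "A = coordinates.rotations U m c x" and m0: "m 0 = int (p ^ n)"
    and m: "\<And>j. j < r \<Longrightarrow> \<exists>i\<in>{1..n}. m j = int (p ^ i)"
    and card: "\<And>i. i \<in> {1..n} \<Longrightarrow>
      card {X \<in> perm_orbits A V. card X = p ^ i} = card {j. j < r \<and> m j = int (p ^ i)}"
    by (rule cyclic_coordinates[OF assms(1-6)]) (rule that)
  interpret coordinates U r m c x by (rule co)
  have k: "k i = card {j. j < r \<and> m j = int (p ^ i)}" if "i \<in> {1..n}" for i
    using assms(7)[OF that] card[OF that] by simp
  have p3: "3 \<le> p" using prime_ge_2_nat[OF assms(1)] assms(2) by linarith
  \<comment> \<open>Every nontrivial orbit has length \<open>p ^ i\<close> for exactly one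
    \<open>i\<close> between 1 and \<open>n\<close>, so the counts add up to the number
    \<open>r\<close> of these orbits.\<close>
  have sum_k: "(\<Sum>i=1..n. k i) = r"
  proof -
    have "(\<Sum>i=1..n. k i) = (\<Sum>i=1..n. card {j. j < r \<and> m j = int (p ^ i)})"
      using k by (intro sum.cong) auto
    also have "\<dots> = card (\<Union>i\<in>{1..n}. {j. j < r \<and> m j = int (p ^ i)})"
    proof (rule card_UN_disjoint[symmetric])
      show "\<forall>i\<in>{1..n}. \<forall>i'\<in>{1..n}. i \<noteq> i' \<longrightarrow>
          {j. j < r \<and> m j = int (p ^ i)} \<inter> {j. j < r \<and> m j = int (p ^ i')} = {}"
        using p3 power_inject_exp[of p] by auto
    qed auto
    also have "(\<Union>i\<in>{1..n}. {j. j < r \<and> m j = int (p ^ i)}) = {..<r}"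
      using m by blast
    finally show ?thesis by simp
  qed
  have up: "(A, V) \<in> GR l" if "(rotations, U) \<in> GR l" "2 \<le> l" for l
    using GR_superset[OF that card_V_ge U assms(4)] by (simp add: A)
  have "(A, V) \<notin> GR_any" if "r = 1"
    using one_orbit_not_GR[OF that U] by (simp add: A)
  moreover have "(A, V) \<in> GR 2" if "2 < r"
    using up[OF three_orbits_GR_2] that by simp
  moreover have "(A, V) \<in> GR_star 3" if r2: "r = 2" and k1: "k 1 \<in> {1, 2}" and p: "p \<in> {3, 5}"
  proof -
    have "k 1 = card {j. j < r \<and> m j = int p}" using k[of 1] assms(3) by simp
    then have "{j. j < r \<and> m j = int p} \<noteq> {}" using k1 by (intro notI) simp
    then obtain j where j: "j < r" "m j = int p" by blast
    \<comment> \<open>The longest orbit has length \<open>p ^ n\<close> with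
      \<open>n \<ge> 2\<close>, so an orbit of length \<open>p\<close> must be orbit 1.\<close>
    have "p ^ 1 < p ^ n" using p3 assms(3) by (intro power_strict_increasing) auto
    then have "j \<noteq> 0" using j(2) m0 by (intro notI) simp
    then have "j = 1" using j(1) r2 by simp
    then have "m 1 = 3 \<or> m 1 = 5" using j(2) p by auto
    from two_orbits_not_GR_2[OF r2 this U] have "(A, V) \<notin> GR 2" by (simp add: A)
    then show ?thesis using up[OF two_orbits_GR_3[OF r2]] by (simp add: GR_star_def)
  qed
  moreover have "(A, V) \<in> GR 2" if r2: "r = 2" and no: "\<not> (k 1 \<in> {1, 2} \<and> p \<in> {3, 5})"
  proof -
    obtain i where i: "i \<in> {1..n}" "m 1 = int (p ^ i)" using m[of 1] r2 by auto
    \<comment> \<open>If \<open>p\<close> is 3 or 5, then no orbit has length \<open>p\<close> and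
      \<open>m 1 \<ge> p ^ 2 \<ge> 9\<close>; otherwise already \<open>p \<ge> 7\<close>.\<close>
    have "7 \<le> p ^ i"
    proof (cases "p \<in> {3, 5}")
      case True
      have k1: "k 1 = card {j. j < r \<and> m j = int (p ^ 1)}" using assms(3) by (intro k) simp
      have "i \<noteq> 1"
      proof
        assume "i = 1"
        then have "{1} \<subseteq> {j. j < r \<and> m j = int (p ^ 1)}" using i r2 by simp
        moreover have "{j. j < r \<and> m j = int (p ^ 1)} \<subseteq> {..<2}" using r2 by auto
        ultimately have "card {1::nat} \<le> k 1" "k 1 \<le> card {..<2::nat}"
          unfolding k1 by (intro card_mono; auto)+
        then show False using no True by auto
      qed
      then have "2 \<le> i" using i(1) by simp
      have "3 ^ 2 \<le> p ^ 2" using p3 by (intro power_mono) auto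
      also have "\<dots> \<le> p ^ i" using p3 \<open>2 \<le> i\<close> by (intro power_increasing) auto
      finally show ?thesis by simp
    next
      case False
      have "\<not> prime (4::nat)" "\<not> prime (6::nat)"
        using prime_odd_nat[of 4] prime_odd_nat[of 6] by auto
      then have "p \<noteq> 4" "p \<noteq> 6" using assms(1) by auto
      then have "7 \<le> p" using p3 False by auto
      also have "p \<le> p ^ i" using i(1) p3 by (intro self_le_power) auto
      finally show ?thesis .
    qed
    from of_nat_mono[OF this, where 'a = int] have "7 \<le> m 1" using i(2) by simp
    then show ?thesis using up[OF two_long_orbits_GR_2[OF r2]] by simp
  qed
  ultimately show ?thesis by (simp add: sum_k del: insert_iff)
qed

end
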